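(* Let $k$ be a field. (1) Let $R=k$. Then the two-dimensional Contou-Carrère symbol $(k((u))((t))^* )^3\to k^*$ coincides with the two-dimensional tame symbol. (2) Let $R=k[\epsilon]/\epsilon^4$. Then for any $f,g,h\in k((u))((t))$ $$(1+\epsilon f,\,1+\epsilon g,\,1+\epsilon h)=1+\epsilon^3\operatorname{Res}\,f\,dg\wedge dh,$$ where $(\cdot,\cdot,\cdot):(R((u))((t))^* )^3\to R^*$ is the two-dimensional Contou-Carrère symbol.
   Context: **Residue.** $dg\wedge dh=\bigl(\frac{\partial g}{\partial u}\frac{\partial h}{\partial t}-\frac{\partial g}{\partial t}\frac{\partial h}{\partial u}\bigr)du\wedge dt$, $\operatorname{Res}(\sum a_{i,j}u^jt^i\,du\wedge dt)=a_{-1,-1}$. **The two-dimensional Contou-Carrère symbol** over a commutative ring $R$ whose nilradical $\mathcal NR$ is a nilpotent ideal. $\mathbb Z(R)$ is the group of locally constant functions $\operatorname{Spec}R\to\mathbf Z$; powers with exponents in $\mathbb Z(R)$ are defined componentwise. Every $f\in R((u))((t))^*$ is uniquely $f=f_{-1}\,f_0\,u^{\nu_2(f)}t^{\nu_1(f)}f_1$ with $f_0\in R^*$, $\nu_1(f),\nu_2(f)\in\mathbb Z(R)$, $f_1\in 1+uR[[u]]+tR((u))[[t]]$, and $f_{-1}-1$ a nilpotent element of $u^{-1}R[u^{-1}]+t^{-1}R((u))[t^{-1}]$. With $\mathbf Z^2\ni(i,j)$ ordered lexicographically, there are unique convergent decompositions $f_1=\prod_{(i,j)\ge(0,1)}(1-a_{i,j}u^jt^i)$,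 $a_{i,j}\in R$, and $f_{-1}=\prod_{(i,j)\le(0,-1),\,i>n_f,\,j>m_f}(1-a_{i,j}u^jt^i)$, $a_{i,j}\in\mathcal N R$ (for some integers $n_f<0$, $m_f$). So $f=f_0u^{\nu_2(f)}t^{\nu_1(f)}\prod_{(i,j)\ne(0,0)}(1-a_{i,j}u^jt^i)$; similarly $g$ with $g_0$, $b_{k,l}$ (factors $1-b_{k,l}u^lt^k$) and $h$ with $h_0$, $c_{m,n}$ (factors $1-c_{m,n}u^nt^m$). Put $\nu(f,g)=\nu_2(f)\nu_1(g)-\nu_2(g)\nu_1(f)$ and $A=\nu(f,g)\nu(f,h)+\nu(g,h)\nu(g,f)+\nu(h,f)\nu(h,g)+\nu(f,g)\nu(f,h)\nu(g,h)$. Define: - $T(a_{i,j},b_{k,l},c_{m,n})$: let $p_0=lm-nk$, $q_0=ni-jm$, $r_0=jk-li$. If $p_0,q_0,r_0$ are all $>0$ or all $<0$, let $d$ be their greatest common divisor, taken with the common sign of $p_0,q_0,r_0$, and $T=(1-a_{i,j}^{p_0/d}b_{k,l}^{q_0/d}c_{m,n}^{r_0/d})^{d}$; otherwise $T=1$. - $S(a_{i,j},b_{k,l})=1$ if $jk-il\neq0$ or $jl+ik\ge0$ or $jl=0$; otherwise $S(a_{i,j},b_{k,l})=\bigl(1-a_{i,j}^{|l/(j,l)|}b_{k,l}^{|j/(j,l)|}\bigr)^{-l|(j,l)|/|l|}$. - $Q(a_{i,j},b_{k,l})=1$ if $jk-il\ne0$ or $jl+ik\ge0$ or $ik=0$;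 otherwise $Q(a_{i,j},b_{k,l})=\bigl(1-a_{i,j}^{|k/(i,k)|}b_{k,l}^{|i/(i,k)|}\bigr)^{k|(i,k)|/|k|}$. Here $(\cdot,\cdot)$ of two integers denotes their gcd. The symbol is $$(f,g,h)=(-1)^Af_0^{\nu(g,h)}g_0^{\nu(h,f)}h_0^{\nu(f,g)}\prod T(a_{i,j},b_{k,l},c_{m,n})\prod S(a_{i,j},b_{k,l})^{\nu_1(h)}Q(a_{i,j},b_{k,l})^{\nu_2(h)}\prod S(c_{m,n},a_{i,j})^{\nu_1(g)}Q(c_{m,n},a_{i,j})^{\nu_2(g)}\prod S(b_{k,l},c_{m,n})^{\nu_1(f)}Q(b_{k,l},c_{m,n})^{\nu_2(f)},$$ products over all $(i,j),(k,l),(m,n)\in\mathbf Z^2\setminus(0,0)$; only finitely many factors differ from $1$. **The two-dimensional tame symbol** of $f,g,h\in k((u))((t))^*$ is $(-1)^A\,\overline{f^{\nu(g,h)}g^{\nu(h,f)}h^{\nu(f,g)}}\in k^*$, where $\nu_1(f),\nu_2(f)\in\mathbf Z$ are the exponents in the unique decomposition $f=f_0u^{\nu_2(f)}t^{\nu_1(f)}f_1$ with $f_0\in k^*$, $f_1\in 1+uk[[u]]+tk((u))[[t]]$ (and likewise for $g$, $h$), $\nu(f,g)=\nu_2(f)\nu_1(g)-\nu_2(g)\nu_1(f)$, $A=\nu(f,g)\nu(f,h)+\nu(g,h)\nu(g,f)+\nu(h,f)\nu(h,g)+\nu(f,g)\nu(f,h)\nu(g,h)$, and where the bar denotes reduction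 first modulo the maximal ideal $tk((u))[[t]]$ of $k((u))[[t]]$ and then modulo the maximal ideal $uk[[u]]$ of $k[[u]]$ (the element $f^{\nu(g,h)}g^{\nu(h,f)}h^{\nu(f,g)}$ has $\nu_1=\nu_2=0$). *)

theory Defs
  imports "HOL-Computational_Algebra.Computational_Algebra" "HOL-Library.Product_Lexorder"
begin

unbundle fps_syntax

section \<open>Spec of a ring and powers with locally constant exponents\<close>

definition prime_ideal :: "'r::comm_ring_1 set \<Rightarrow> bool" where
  "prime_ideal P \<longleftrightarrow>
     0 \<in> P \<and> (\<forall>x\<in>P. \<forall>y\<in>P. x + y \<in> P) \<and> (\<forall>a. \<forall>x\<in>P. a * x \<in> P) \<and>
     1 \<notin> P \<and> (\<forall>x y. x * y \<in> P \<longrightarrow> x \<in> P \<or> y \<in> P)"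

definition Spec :: "'r::comm_ring_1 set set" where
  "Spec = {P. prime_ideal P}"

text \<open>Zariski topology: the sets \<open>D(a) = {P \<in> Spec. a \<notin> P}\<close> form a base.
  An element of \<open>\<int>(R)\<close> is represented by a function on all subsets of \<open>R\<close>; only its
  values on \<^const>\<open>Spec\<close> are ever used.\<close>

definition loc_const :: "('r::comm_ring_1 set \<Rightarrow> int) \<Rightarrow> bool" where
  "loc_const \<nu> \<longleftrightarrow> (\<forall>P\<in>Spec. \<exists>a. a \<notin> P \<and> (\<forall>Q\<in>Spec. a \<notin> Q \<longrightarrow> \<nu> Q = \<nu> P))"

definition unit_inv :: "'a::comm_ring_1 \<Rightarrow> 'a" where
  "unit_inv x = (THE y. x * y = 1)"

definition unit_pow :: "'a::comm_ring_1 \<Rightarrow> int \<Rightarrow> 'a" where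
  "unit_pow x n = (if n \<ge> 0 then x ^ nat n else unit_inv x ^ nat (- n))"

text \<open>Let \<open>A\<close> be an \<open>R\<close>-algebra with structure map \<open>\<iota>\<close>, \<open>x\<close> a unit of \<open>A\<close> and \<open>\<nu> \<in> \<int>(R)\<close>.
  The locus where \<open>\<nu> = n\<close> is \<open>D(e\<^sub>n)\<close> for an idempotent \<open>e\<^sub>n\<close>, and \<open>R\<close> is the product of the
  finitely many nonzero components \<open>e\<^sub>n R\<close>; the power \<open>x\<^sup>\<nu>\<close> is the element that
  equals \<open>x\<^sup>n\<close> in the component \<open>e\<^sub>n A\<close>.\<close>

definition lc_pow ::
    "('r::comm_ring_1 \<Rightarrow> 'a::comm_ring_1) \<Rightarrow> 'a \<Rightarrow> ('r set \<Rightarrow> int) \<Rightarrow> 'a" where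
  "lc_pow \<iota> x \<nu> = (THE y. \<forall>n e. e * e = e \<and> (\<forall>P\<in>Spec. e \<notin> P \<longrightarrow> \<nu> P = n) \<longrightarrow>
                              \<iota> e * y = \<iota> e * unit_pow x n)"


section \<open>Iterated Laurent series\<close>

text \<open>\<open>R((u))((t))\<close> is the type \<open>'r fls fls\<close>: the outer variable is \<open>t\<close>, the inner one is \<open>u\<close>,
  so the coefficient of \<open>u\<^sup>jt\<^sup>i\<close> in \<open>f\<close> is \<open>f $$ i $$ j\<close>. Exponents are recorded as
  pairs \<open>(i, j)\<close>, with the power of \<open>t\<close> first, and pairs are ordered lexicographically.\<close>

definition const2 :: "'r::zero \<Rightarrow> 'r fls fls" where
  "const2 c = fls_const (fls_const c)"

definition u_var :: "'r::{zero,one} fls fls" where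
  "u_var = fls_const fls_X"

definition t_var :: "'r::{zero,one} fls fls" where
  "t_var = fls_X"

definition monom2 :: "'r::comm_ring_1 \<Rightarrow> int \<times> int \<Rightarrow> 'r fls fls" where
  "monom2 c = (\<lambda>(i, j). const2 c * unit_pow u_var j * unit_pow t_var i)"

definition supp2 :: "'r::zero fls fls \<Rightarrow> (int \<times> int) set" where
  "supp2 f = {(i, j). f $$ i $$ j \<noteq> 0}"

text \<open>Coefficientwise application of a map with \<open>\<phi> 0 = 0\<close>.\<close>

definition fls_map :: "('a::zero \<Rightarrow> 'b::zero) \<Rightarrow> 'a fls \<Rightarrow> 'b fls" where
  "fls_map \<phi> f = Abs_fls (\<lambda>n. \<phi> (f $$ n))"

lemma fls_map_nth [simp]:
  assumes "\<phi> 0 = 0"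
  shows "fls_map \<phi> f $$ n = \<phi> (f $$ n)"
  unfolding fls_map_def
  by (rule nth_Abs_fls_lower_bound[of "fls_subdegree f"]) (simp add: assms)

text \<open>The base of neighbourhoods of \<open>0\<close> for the topology of \<open>R((u))((t))\<close> (with \<open>R\<close> discrete
  and \<open>R((u))\<close> \<open>u\<close>-adic): no condition on the coefficients of \<open>t\<^sup>i\<close> for \<open>i \<ge> N\<close>, and
  the coefficient of \<open>t\<^sup>i\<close> lies in \<open>u\<^bsup>m i\<^esup>R[[u]]\<close> for \<open>i < N\<close>.\<close>

definition nhd0 :: "(int \<Rightarrow> int) \<Rightarrow> int \<Rightarrow> 'r::zero fls fls set" where
  "nhd0 m N = {f. \<forall>i<N. \<forall>j<m i. f $$ i $$ j = 0}"

text \<open>Convergence of the family of factors \<open>1 - a\<^sub>i\<^sub>ju\<^sup>jt\<^sup>i\<close>, \<open>(i,j) \<in> I\<close>: the net of finite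
  partial products tends to \<open>x\<close>.\<close>

definition has_prod2 ::
    "(int \<times> int \<Rightarrow> 'r::comm_ring_1) \<Rightarrow> (int \<times> int) set \<Rightarrow> 'r fls fls \<Rightarrow> bool" where
  "has_prod2 a I x \<longleftrightarrow>
     (\<forall>m N. eventually (\<lambda>F. (\<Prod>p\<in>F. 1 - monom2 (a p) p) - x \<in> nhd0 m N)
              (finite_subsets_at_top I))"


section \<open>The canonical decomposition\<close>

definition nilpotent :: "'a::comm_ring_1 \<Rightarrow> bool" where
  "nilpotent x \<longleftrightarrow> (\<exists>n. x ^ n = 0)"

record 'r decomp =
  lead :: 'r
  nu1  :: "'r set \<Rightarrow> int"
  nu2  :: "'r set \<Rightarrow> int"
  cf   :: "int \<times> int \<Rightarrow> 'r"

text \<open>\<open>1 + uR[[u]] + tR((u))[[t]]\<close>\<close>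

definition pos_units :: "'r::comm_ring_1 fls fls set" where
  "pos_units = {f. supp2 (f - 1) \<subseteq> {(0, 1)..}}"

text \<open>Elements \<open>x\<close> such that \<open>x - 1\<close> is a nilpotent element of
  \<open>u\<^sup>-\<^sup>1R[u\<^sup>-\<^sup>1] + t\<^sup>-\<^sup>1R((u))[t\<^sup>-\<^sup>1]\<close>\<close>

definition neg_units :: "'r::comm_ring_1 fls fls set" where
  "neg_units = {f. supp2 (f - 1) \<subseteq> {..(0, -1)} \<and> nilpotent (f - 1)}"

definition is_decomp :: "'r::comm_ring_1 fls fls \<Rightarrow> 'r decomp \<Rightarrow> bool" where
  "is_decomp f D \<longleftrightarrow>
     lead D dvd 1 \<and> loc_const (nu1 D) \<and> loc_const (nu2 D) \<and>
     (\<exists>f_neg\<in>neg_units. \<exists>f_pos\<in>pos_units.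
        f = f_neg * const2 (lead D) * lc_pow const2 u_var (nu2 D) * lc_pow const2 t_var (nu1 D)
              * f_pos \<and>
        has_prod2 (cf D) {(0, 1)..} f_pos \<and>
        (\<exists>n m. n < 0 \<and>
           has_prod2 (cf D) {(i, j). (i, j) \<le> (0, -1) \<and> n < i \<and> m < j} f_neg \<and>
           (\<forall>i j. (i, j) \<le> (0, -1) \<longrightarrow>
              nilpotent (cf D (i, j)) \<and> (\<not> (n < i \<and> m < j) \<longrightarrow> cf D (i, j) = 0))))"

text \<open>If the nilradical of \<open>R\<close> is a nilpotent ideal, every unit \<open>f\<close> of \<open>R((u))((t))\<close> has a
  decomposition, and it is unique up to the irrelevant values of the exponents
  outside \<^const>\<open>Spec\<close> and of the coefficients at \<open>(0, 0)\<close>.\<close>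

definition decomp_of :: "'r::comm_ring_1 fls fls \<Rightarrow> 'r decomp" where
  "decomp_of f = (SOME D. is_decomp f D)"


section \<open>The two-dimensional Contou-Carrere symbol\<close>

text \<open>For \<open>x = (\<nu>\<^sub>1(f), \<nu>\<^sub>2(f))\<close> and \<open>y = (\<nu>\<^sub>1(g), \<nu>\<^sub>2(g))\<close> this is \<open>\<nu>(f, g)\<close>.\<close>

definition nu_pair :: "int \<times> int \<Rightarrow> int \<times> int \<Rightarrow> int" where
  "nu_pair x y = snd x * fst y - snd y * fst x"

definition sign_exp :: "int \<times> int \<Rightarrow> int \<times> int \<Rightarrow> int \<times> int \<Rightarrow> int" where
  "sign_exp x y z =
     nu_pair x y * nu_pair x z + nu_pair y z * nu_pair y x + nu_pair z x * nu_pair z y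
     + nu_pair x y * nu_pair x z * nu_pair y z"

definition cc_T ::
    "(int \<times> int \<Rightarrow> 'r::comm_ring_1) \<Rightarrow> (int \<times> int \<Rightarrow> 'r) \<Rightarrow> (int \<times> int \<Rightarrow> 'r)
       \<Rightarrow> int \<times> int \<Rightarrow> int \<times> int \<Rightarrow> int \<times> int \<Rightarrow> 'r" where
  "cc_T a b c = (\<lambda>(i, j) (k, l) (m, n).
     let p = l * m - n * k; q = n * i - j * m; r = j * k - l * i; d = sgn p * gcd p (gcd q r)
     in if (p > 0 \<and> q > 0 \<and> r > 0) \<or> (p < 0 \<and> q < 0 \<and> r < 0)
        then unit_pow (1 - a (i, j) ^ nat (p div d) * b (k, l) ^ nat (q div d)
                           * c (m, n) ^ nat (r div d)) d
        else 1)"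

definition cc_S ::
    "(int \<times> int \<Rightarrow> 'r::comm_ring_1) \<Rightarrow> (int \<times> int \<Rightarrow> 'r) \<Rightarrow> int \<times> int \<Rightarrow> int \<times> int \<Rightarrow> 'r" where
  "cc_S a b = (\<lambda>(i, j) (k, l).
     if j * k - i * l \<noteq> 0 \<or> j * l + i * k \<ge> 0 \<or> j * l = 0 then 1
     else unit_pow (1 - a (i, j) ^ nat \<bar>l div gcd j l\<bar> * b (k, l) ^ nat \<bar>j div gcd j l\<bar>)
            (- (l * \<bar>gcd j l\<bar> div \<bar>l\<bar>)))"

definition cc_Q ::
    "(int \<times> int \<Rightarrow> 'r::comm_ring_1) \<Rightarrow> (int \<times> int \<Rightarrow> 'r) \<Rightarrow> int \<times> int \<Rightarrow> int \<times> int \<Rightarrow> 'r" where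
  "cc_Q a b = (\<lambda>(i, j) (k, l).
     if j * k - i * l \<noteq> 0 \<or> j * l + i * k \<ge> 0 \<or> i * k = 0 then 1
     else unit_pow (1 - a (i, j) ^ nat \<bar>k div gcd i k\<bar> * b (k, l) ^ nat \<bar>i div gcd i k\<bar>)
            (k * \<bar>gcd i k\<bar> div \<bar>k\<bar>))"

text \<open>\<^const>\<open>prod'\<close> is the product over an infinite index set with finitely many factors
  different from \<open>1\<close>.\<close>

definition cc_SQ ::
    "(int \<times> int \<Rightarrow> 'r::comm_ring_1) \<Rightarrow> (int \<times> int \<Rightarrow> 'r)
       \<Rightarrow> ('r set \<Rightarrow> int) \<Rightarrow> ('r set \<Rightarrow> int) \<Rightarrow> 'r" where
  "cc_SQ a b \<nu>1 \<nu>2 =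
     prod' (\<lambda>(x, y). lc_pow id (cc_S a b x y) \<nu>1 * lc_pow id (cc_Q a b x y) \<nu>2)
       ((- {(0, 0)}) \<times> (- {(0, 0)}))"

definition cc_symbol ::
    "'r::comm_ring_1 fls fls \<Rightarrow> 'r fls fls \<Rightarrow> 'r fls fls \<Rightarrow> 'r" where
  "cc_symbol f g h =
     (let F = decomp_of f; G = decomp_of g; H = decomp_of h;
          \<nu> = (\<lambda>X P. (nu1 X P, nu2 X P))
      in lc_pow id (- 1) (\<lambda>P. sign_exp (\<nu> F P) (\<nu> G P) (\<nu> H P))
         * lc_pow id (lead F) (\<lambda>P. nu_pair (\<nu> G P) (\<nu> H P))
         * lc_pow id (lead G) (\<lambda>P. nu_pair (\<nu> H P) (\<nu> F P))
         * lc_pow id (lead H) (\<lambda>P. nu_pair (\<nu> F P) (\<nu> G P))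
         * prod' (\<lambda>(x, y, z). cc_T (cf F) (cf G) (cf H) x y z)
             ((- {(0, 0)}) \<times> (- {(0, 0)}) \<times> (- {(0, 0)}))
         * cc_SQ (cf F) (cf G) (nu1 H) (nu2 H)
         * cc_SQ (cf H) (cf F) (nu1 G) (nu2 G)
         * cc_SQ (cf G) (cf H) (nu1 F) (nu2 F))"


section \<open>The two-dimensional tame symbol\<close>

definition tame_val :: "'k::field fls fls \<Rightarrow> int \<times> int" where
  "tame_val f = (THE (v1, v2). \<exists>c f1. c \<noteq> 0 \<and> f1 \<in> pos_units \<and>
                    f = const2 c * u_var powi v2 * t_var powi v1 * f1)"

text \<open>Reduction modulo \<open>t\<close> and modulo \<open>u\<close> is evaluation of the constant coefficient.\<close>

definition tame_symbol :: "'k::field fls fls \<Rightarrow> 'k fls fls \<Rightarrow> 'k fls fls \<Rightarrow> 'k" where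
  "tame_symbol f g h =
     (let x = tame_val f; y = tame_val g; z = tame_val h
      in (- 1) powi sign_exp x y z *
         (f powi nu_pair y z * g powi nu_pair z x * h powi nu_pair x y) $$ 0 $$ 0)"


section \<open>Differential forms and residue\<close>

definition deriv_t :: "'r::comm_ring_1 fls fls \<Rightarrow> 'r fls fls" where
  "deriv_t g = fls_deriv g"

definition deriv_u :: "'r::comm_ring_1 fls fls \<Rightarrow> 'r fls fls" where
  "deriv_u g = fls_map fls_deriv g"

text \<open>A form \<open>w du \<and> dt\<close> is represented by \<open>w\<close>; so \<open>wedge_d g h\<close> represents \<open>dg \<and> dh\<close>.\<close>

definition wedge_d :: "'r::comm_ring_1 fls fls \<Rightarrow> 'r fls fls \<Rightarrow> 'r fls fls" where
  "wedge_d g h = deriv_u g * deriv_t h - deriv_t g * deriv_u h"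

definition Res2 :: "'r::comm_ring_1 fls fls \<Rightarrow> 'r" where
  "Res2 w = w $$ (-1) $$ (-1)"


section \<open>The ring k[eps]/eps^4\<close>

quotient_type (overloaded) 'k eps4 = "'k::field poly" / "\<lambda>p q. monom 1 4 dvd p - q"
proof (rule equivpI)
  show "reflp (\<lambda>p q :: 'k poly. monom 1 4 dvd p - q)"
    by (auto intro: reflpI)
  show "symp (\<lambda>p q :: 'k poly. monom 1 4 dvd p - q)"
    by (intro sympI) (subst dvd_diff_commute)
  show "transp (\<lambda>p q :: 'k poly. monom 1 4 dvd p - q)"
  proof (rule transpI)
    fix p q r :: "'k poly"
    assume "monom 1 4 dvd p - q" "monom 1 4 dvd q - r"
    then have "monom 1 4 dvd (p - q) + (q - r)" by (rule dvd_add)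
    then show "monom 1 4 dvd p - r" by simp
  qed
qed

instantiation eps4 :: (field) comm_ring_1
begin

lift_definition zero_eps4 :: "'a eps4" is 0 .

lift_definition one_eps4 :: "'a eps4" is 1 .

lift_definition plus_eps4 :: "'a eps4 \<Rightarrow> 'a eps4 \<Rightarrow> 'a eps4" is "(+)"
  by (simp add: add_diff_add dvd_add)

lift_definition minus_eps4 :: "'a eps4 \<Rightarrow> 'a eps4 \<Rightarrow> 'a eps4" is "(-)"
proof -
  fix p p' q q' :: "'a poly"
  assume "monom 1 4 dvd p - p'" "monom 1 4 dvd q - q'"
  then have "monom 1 4 dvd (p - p') - (q - q')" by (rule dvd_diff)
  then show "monom 1 4 dvd (p - q) - (p' - q')" by (simp add: algebra_simps)
qed

lift_definition uminus_eps4 :: "'a eps4 \<Rightarrow> 'a eps4" is uminus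
  by (simp add: dvd_diff_commute)

lift_definition times_eps4 :: "'a eps4 \<Rightarrow> 'a eps4 \<Rightarrow> 'a eps4" is "(*)"
proof -
  fix p p' q q' :: "'a poly"
  assume "monom 1 4 dvd p - p'" "monom 1 4 dvd q - q'"
  then have "monom 1 4 dvd (p - p') * q + p' * (q - q')"
    by (intro dvd_add dvd_mult dvd_mult2)
  then show "monom 1 4 dvd p * q - p' * q'"
    by (simp add: algebra_simps)
qed

instance
proof
  show "(0 :: 'a eps4) \<noteq> 1"
    by transfer (auto simp: monom_1_dvd_iff' intro!: exI[of _ 0])
qed (transfer, simp add: algebra_simps)+

end

lift_definition eps4_const :: "'k::field \<Rightarrow> 'k eps4" is "\<lambda>c. [:c:]" .

lift_definition eps :: "'k::field eps4" is "[:0, 1:]" .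

text \<open>The inclusion \<open>k((u))((t)) \<rightarrow> R((u))((t))\<close> for \<open>R = k[\<epsilon>]/\<epsilon>\<^sup>4\<close>\<close>

definition embed2 :: "'k::field fls fls \<Rightarrow> 'k eps4 fls fls" where
  "embed2 f = fls_map (fls_map eps4_const) f"

end

theory Submission
  imports Defs "HOL-Library.Product_Plus"
begin

text \<open>
Both parts rest on knowing the decomposition of a unit well enough to see which factors of the symbol differ
from \<open>1\<close>. The symbol is evaluated at some decomposition, so existence is needed as well as information
about an arbitrary decomposition.

Over a field, nilpotence makes the factor with negative exponents trivial, so only exponents that are lexicographically
positive carry coefficients. A factor \<open>T\<close> can differ from \<open>1\<close> only if a positive combination of its three
exponent vectors vanishes, and a factor \<open>S\<close> or \<open>Q\<close> only if its two vectors point in opposite directions; neither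
is possible for positive vectors (\<open>cc_T_eq_1\<close>, \<open>cc_S_cc_Q_eq_1\<close>). What is left, the sign and the powers of
the leading coefficients, is the tame symbol, because leading terms multiply (\<open>tame_symbol_eq\<close>).
Existence of the decomposition amounts to writing a series with positive exponents as an infinite product; its
coefficients are found by well-founded recursion (\<open>pos_units_has_prod2\<close>).

Over \<open>k[\<epsilon>]/\<epsilon>\<^sup>4\<close>, a decomposition of \<open>1 + \<epsilon> f\<close> exists by successive approximation along the powers of \<open>\<epsilon>\<close>
(\<open>nilpotent_factorization_exists\<close>). In every decomposition the exponents are \<open>0\<close>, and the coefficient at
\<open>p \<noteq> 0\<close> is \<open>- \<epsilon> f\<^sub>p\<close> modulo \<open>\<epsilon>\<^sup>2\<close> (\<open>decomp_near_1\<close>). So the symbol reduces to the product of the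
factors \<open>T\<close>. Each contains at least three coefficients divisible by \<open>\<epsilon>\<close>, and more than three give \<open>0\<close>;
exactly three occur if and only if the exponents \<open>x, y, z\<close> have sum \<open>0\<close> and are not parallel. Then
\<open>T = 1 + \<epsilon>\<^sup>3 det(y, z) f\<^sub>x g\<^sub>y h\<^sub>z\<close> (\<open>cc_T_nilpotent\<close>). Multiplying these factors adds up the determinants,
and the same sum is obtained by expanding the residue of \<open>f dg \<and> dh\<close> into monomials (\<open>Res2_triple_sum\<close>).

Infinite products are controlled through their coefficients: the coefficient at \<open>q\<close> of a product of factors
\<open>1 - a\<^sub>p u\<^sup>jt\<^sup>i\<close> is a sum over finite sets of exponents with sum \<open>q\<close>, and a product converges as soon as
each neighbourhood of \<open>0\<close> involves only finitely many exponents (\<open>has_prod2_exists\<close>).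
\<close>

text \<open>Exponents are handled as vectors of \<open>\<int>\<^sup>2\<close>, so quantifiers over them are kept whole.\<close>

declare split_paired_All [simp del] split_paired_Ex [simp del]

section \<open>Coefficients of iterated Laurent series\<close>

definition coeff2 :: "'r::zero fls fls \<Rightarrow> int \<times> int \<Rightarrow> 'r" where
  "coeff2 f p = f $$ fst p $$ snd p"

lemma coeff2_eqI: "(\<And>p. coeff2 f p = coeff2 g p) \<Longrightarrow> f = g"
  unfolding coeff2_def fls_eq_iff by (metis fst_conv snd_conv)

lemma coeff2_arith [simp]:
  "coeff2 0 p = 0"
  "coeff2 (x + y) p = coeff2 x p + coeff2 y p"
  "coeff2 (x' - y') p = coeff2 x' p - coeff2 y' p"
  "coeff2 (- x') p = - coeff2 x' p"
  by (simp_all add: coeff2_def)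

lemma coeff2_1: "coeff2 (1 :: 'r::zero_neq_one fls fls) p = (if p = 0 then 1 else 0)"
  by (cases p) (simp add: coeff2_def zero_prod_def)

lemma coeff2_sum: "coeff2 (\<Sum>x\<in>A. f x) p = (\<Sum>x\<in>A. coeff2 (f x) p)"
  by (induction A rule: infinite_finite_induct) auto

lemma coeff2_const2: "coeff2 (const2 c) p = (if p = 0 then c else 0)"
  by (cases p) (simp add: coeff2_def const2_def zero_prod_def)

lemma fls_nth_mult:
  fixes f g :: "'a::{comm_monoid_add,mult_zero} fls" and n :: int
  defines "I \<equiv> {i. f $$ i \<noteq> 0 \<and> g $$ (n - i) \<noteq> 0}"
  shows "finite I" and "(f * g) $$ n = (\<Sum>i\<in>I. f $$ i * g $$ (n - i))"
proof -
  have *: "I \<subseteq> {fls_subdegree f..n - fls_subdegree g}"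
  proof
    fix i assume "i \<in> I"
    then have "\<not> i < fls_subdegree f" "\<not> n - i < fls_subdegree g"
      unfolding I_def using fls_eq0_below_subdegree by blast+
    then show "i \<in> {fls_subdegree f..n - fls_subdegree g}" by simp
  qed
  show "finite I"
    by (rule finite_subset[OF *]) simp
  show "(f * g) $$ n = (\<Sum>i\<in>I. f $$ i * g $$ (n - i))"
    unfolding fls_times_nth(2)
    by (intro sum.mono_neutral_right) (use * in \<open>auto simp: I_def\<close>)
qed

lemma coeff2_mult:
  fixes f g :: "'a::comm_ring_1 fls fls" and q :: "int \<times> int"
  defines "K \<equiv> {p. coeff2 f p \<noteq> 0 \<and> coeff2 g (q - p) \<noteq> 0}"
  shows "finite K" and "coeff2 (f * g) q = (\<Sum>p\<in>K. coeff2 f p * coeff2 g (q - p))"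
proof -
  obtain n m where q: "q = (n, m)" by force
  define I where "I = {i. f $$ i \<noteq> 0 \<and> g $$ (n - i) \<noteq> 0}"
  define J where "J = (\<lambda>i. {j. f $$ i $$ j \<noteq> 0 \<and> g $$ (n - i) $$ (m - j) \<noteq> 0})"
  have fin: "finite I" "finite (J i)" for i
    unfolding I_def J_def by (rule fls_nth_mult)+
  have K: "K = (SIGMA i:I. J i)"
    unfolding K_def I_def J_def coeff2_def q by force
  show "finite K"
    unfolding K using fin by auto
  have nth_sum: "(\<Sum>i\<in>A. h i) $$ m = (\<Sum>i\<in>A. h i $$ m)" for A and h :: "int \<Rightarrow> 'a fls"
    by (induction A rule: infinite_finite_induct) auto
  have "coeff2 (f * g) q = (\<Sum>i\<in>I. (f $$ i * g $$ (n - i)) $$ m)"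
    unfolding coeff2_def q fst_conv snd_conv fls_nth_mult(2)[of f] I_def nth_sum ..
  also have "\<dots> = (\<Sum>i\<in>I. \<Sum>j\<in>J i. f $$ i $$ j * g $$ (n - i) $$ (m - j))"
    unfolding J_def by (intro sum.cong refl) (rule fls_nth_mult)
  also have "\<dots> = (\<Sum>p\<in>K. coeff2 f p * coeff2 g (q - p))"
    unfolding K using fin by (subst sum.Sigma) (auto simp: coeff2_def q case_prod_beta)
  finally show "coeff2 (f * g) q = (\<Sum>p\<in>K. coeff2 f p * coeff2 g (q - p))" .
qed

lemma coeff2_mult_superset:
  fixes f g :: "'a::comm_ring_1 fls fls"
  assumes "finite K" "\<And>p. p \<notin> K \<Longrightarrow> coeff2 f p = 0 \<or> coeff2 g (q - p) = 0"
  shows "coeff2 (f * g) q = (\<Sum>p\<in>K. coeff2 f p * coeff2 g (q - p))"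
  unfolding coeff2_mult(2)
  by (intro sum.mono_neutral_left assms(1)) (use assms(2) in force)+

lemma coeff2_const2_mult: "coeff2 (const2 c * f) q = c * coeff2 (f :: 'a::comm_ring_1 fls fls) q"
  by (subst coeff2_mult_superset[of "{0}"]) (auto simp: coeff2_const2)

lemma unit_inv_eqI:
  assumes "x * y = (1 :: 'a::comm_ring_1)" shows "unit_inv x = y"
  unfolding unit_inv_def
proof (rule the_equality)
  fix z assume "x * z = 1"
  have "z = (x * y) * z" using assms by simp
  also have "\<dots> = y * (x * z)" by (simp add: algebra_simps)
  finally show "z = y" using \<open>x * z = 1\<close> by simp
qed (rule assms)

lemma unit_pow_0 [simp]: "unit_pow x 0 = 1"
  by (simp add: unit_pow_def)

lemma unit_pow_1 [simp]: "unit_pow 1 n = 1"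
proof -
  have "unit_inv (1::'a) = 1" by (rule unit_inv_eqI) simp
  then show ?thesis by (simp add: unit_pow_def)
qed

lemma unit_pow_field: "unit_pow (x :: 'a::field) n = x powi n" if "x \<noteq> 0"
proof -
  have "unit_inv x = inverse x" using that by (intro unit_inv_eqI) simp
  then show ?thesis by (simp add: unit_pow_def power_int_def)
qed

lemma unit_pow_X: "unit_pow (fls_X :: 'a::comm_ring_1 fls) n = fls_X_intpow n"
proof -
  have "unit_inv (fls_X :: 'a fls) = fls_X_inv"
    by (rule unit_inv_eqI) (simp add: fls_X_times_conv_shift fls_X_inv_conv_shift_1)
  then show ?thesis
    by (simp add: unit_pow_def fls_X_power_conv_shift_1 fls_X_inv_power_conv_shift_1)
qed

lemma fls_const_power: "fls_const c ^ n = fls_const (c ^ n)" for c :: "'a::comm_ring_1"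
  by (induction n) auto

lemma unit_pow_fls_const:
  assumes "x * y = (1 :: 'a::comm_ring_1)"
  shows "unit_pow (fls_const x) n = fls_const (unit_pow x n)"
proof -
  have "unit_inv (fls_const x) = fls_const y" "unit_inv x = y"
    using assms by (auto intro!: unit_inv_eqI)
  then show ?thesis by (simp add: unit_pow_def fls_const_power)
qed

lemma unit_pow_vars:
  "unit_pow (u_var :: 'a::comm_ring_1 fls fls) j = fls_const (fls_X_intpow j)"
  "unit_pow (t_var :: 'a::comm_ring_1 fls fls) i = fls_X_intpow i"
proof -
  have "fls_X * (fls_X_inv :: 'a fls) = 1"
    by (simp add: fls_X_times_conv_shift fls_X_inv_conv_shift_1)
  from unit_pow_fls_const[OF this] show "unit_pow (u_var :: 'a fls fls) j = fls_const (fls_X_intpow j)"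
    by (simp add: u_var_def unit_pow_X)
qed (simp add: t_var_def unit_pow_X)

lemma monom2_eq: "monom2 c p = fls_shift (- fst p) (fls_const (fls_shift (- snd p) (fls_const c)))"
  by (cases p) (simp add: monom2_def unit_pow_vars const2_def fls_X_intpow_times_conv_shift)

lemma coeff2_monom2: "coeff2 (monom2 c p) q = (if q = p then c else 0)"
  by (cases p; cases q) (auto simp: coeff2_def monom2_eq)

lemma monom2_mult: "monom2 c p * monom2 d q = monom2 (c * d :: 'a::comm_ring_1) (p + q)"
  by (rule coeff2_eqI, subst coeff2_mult_superset[of "{p}"]) (auto simp: coeff2_monom2 algebra_simps)

lemma monom2_0 [simp]: "monom2 (0::'a::comm_ring_1) p = 0"
  by (rule coeff2_eqI) (auto simp: coeff2_monom2)

lemma monom2_uminus: "- monom2 c p = monom2 (- c :: 'a::comm_ring_1) p"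
  by (rule coeff2_eqI) (auto simp: coeff2_monom2)

lemma monom2_1_0: "monom2 (1::'a::comm_ring_1) 0 = 1"
  by (rule coeff2_eqI) (auto simp: coeff2_monom2 coeff2_1)

lemma prod_monom2:
  "(\<Prod>p\<in>S. monom2 (c p) (w p)) = monom2 (\<Prod>p\<in>S. c p :: 'a::comm_ring_1) (\<Sum>p\<in>S. w p)"
  by (induction S rule: infinite_finite_induct) (auto simp: monom2_mult monom2_1_0)

lemma coeff2_monom2_mult: "coeff2 (monom2 c p * f) q = c * coeff2 (f :: 'a::comm_ring_1 fls fls) (q - p)"
  by (subst coeff2_mult_superset[of "{p}"]) (auto simp: coeff2_monom2)

lemma series_with_coeffs_exists:
  assumes "\<And>i j. i < n \<Longrightarrow> c (i, j) = 0" "\<And>i j. j < b i \<Longrightarrow> c (i, j) = 0"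
  shows "\<exists>x. \<forall>p. coeff2 x p = c p"
proof -
  have 1: "Abs_fls (\<lambda>j. c (i, j)) $$ j = c (i, j)" for i j
    by (rule nth_Abs_fls_lower_bound[of "b i"]) (use assms(2) in auto)
  have 2: "Abs_fls (\<lambda>i. Abs_fls (\<lambda>j. c (i, j))) $$ i = Abs_fls (\<lambda>j. c (i, j))" for i
  proof (rule nth_Abs_fls_lower_bound[of n], safe)
    fix i assume "i < n"
    then show "Abs_fls (\<lambda>j. c (i, j)) = 0"
      using assms(1) by (simp add: fls_eq_iff 1)
  qed
  show ?thesis
    by (rule exI[of _ "Abs_fls (\<lambda>i. Abs_fls (\<lambda>j. c (i, j)))"]) (simp add: coeff2_def 1 2)
qed

lemma coeff2_bounds:
  "\<exists>n b. (\<forall>i<n. \<forall>j. coeff2 x (i, j) = 0) \<and> (\<forall>i. \<forall>j<b i. coeff2 x (i, j) = 0)"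
  by (rule exI[of _ "fls_subdegree x"], rule exI[of _ "\<lambda>i. fls_subdegree (x $$ i)"])
    (simp add: coeff2_def)

lemma series_restrict_exists: "\<exists>y. \<forall>p. coeff2 y p = (if p \<in> I then coeff2 x p else 0)"
proof -
  obtain n b where "\<forall>i<n. \<forall>j. coeff2 x (i, j) = 0" "\<forall>i. \<forall>j<b i. coeff2 x (i, j) = 0"
    using coeff2_bounds by blast
  then show ?thesis by (intro series_with_coeffs_exists[of n _ b]) auto
qed

section \<open>Convergence of infinite products\<close>

text \<open>Expanding \<open>\<Prod>p\<in>I. 1 - a\<^sub>p u\<^sup>jt\<^sup>i\<close> selects a finite set \<open>S\<close> of factors that contribute their
second term, and the selection lands on the exponent \<open>\<Sum>S\<close>. For infinite \<open>I\<close> this is the only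
candidate for the coefficient of the limit. Selections whose product vanishes are excluded, so that the
index set can be finite although infinitely many subsets of \<open>I\<close> have sum \<open>q\<close>.\<close>

definition prod_coeff :: "(int \<times> int \<Rightarrow> 'r::comm_ring_1) \<Rightarrow> (int \<times> int) set \<Rightarrow> int \<times> int \<Rightarrow> 'r" where
  "prod_coeff a I q =
     (\<Sum>S | finite S \<and> S \<subseteq> I \<and> (\<Prod>p\<in>S. - a p) \<noteq> 0 \<and> \<Sum>S = q. \<Prod>p\<in>S. - a p)"

lemma coeff2_finite_prod:
  assumes "finite F"
  shows "coeff2 (\<Prod>p\<in>F. 1 - monom2 (a p) p) q = prod_coeff a F q"
proof -
  have "(\<Prod>p\<in>F. 1 - monom2 (a p) p) = (\<Prod>p\<in>F. monom2 (- a p) p + 1)"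
    by (simp add: monom2_uminus[symmetric])
  also have "\<dots> = (\<Sum>S\<in>Pow F. monom2 (\<Prod>p\<in>S. - a p) (\<Sum>S))"
    by (simp add: prod_add[OF assms] prod_monom2)
  finally have "coeff2 (\<Prod>p\<in>F. 1 - monom2 (a p) p) q
      = (\<Sum>S\<in>Pow F. if q = \<Sum>S then \<Prod>p\<in>S. - a p else 0)"
    by (simp add: coeff2_sum coeff2_monom2)
  also have "\<dots> = prod_coeff a F q"
    unfolding prod_coeff_def
    by (rule sum.mono_neutral_cong_right) (use assms in \<open>auto intro: finite_subset\<close>)
  finally show ?thesis .
qed

lemma prod_coeff_cong:
  assumes "\<And>S. finite S \<Longrightarrow> S \<subseteq> I \<Longrightarrow> (\<Prod>p\<in>S. - a p) \<noteq> 0 \<Longrightarrow> \<Sum>S = q \<Longrightarrow> S \<subseteq> K"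
    and "I \<inter> K \<subseteq> F" "F \<subseteq> I"
  shows "prod_coeff a I q = prod_coeff a F q"
  unfolding prod_coeff_def by (rule sum.cong) (use assms in blast)+

text \<open>The neighbourhood given by \<open>N = i + 1\<close> and the constant bound \<open>j + 1\<close> sees the coefficient at
\<open>(i, j)\<close>, so convergence makes each single coefficient eventually constant. All properties of limits
are derived from finite products through this fact.\<close>

lemma has_prod2_finite_coeff:
  assumes "has_prod2 a I x"
  shows "\<exists>F. finite F \<and> F \<subseteq> I \<and>
           (\<forall>F'. finite F' \<and> F \<subseteq> F' \<and> F' \<subseteq> I \<longrightarrow> coeff2 x q = prod_coeff a F' q)"
proof -
  have "eventually (\<lambda>F. (\<Prod>p\<in>F. 1 - monom2 (a p) p) - x \<in> nhd0 (\<lambda>_. snd q + 1) (fst q + 1))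
          (finite_subsets_at_top I)"
    using assms unfolding has_prod2_def by blast
  then obtain F where F: "finite F" "F \<subseteq> I" "\<And>F'. finite F' \<and> F \<subseteq> F' \<and> F' \<subseteq> I \<Longrightarrow>
      (\<Prod>p\<in>F'. 1 - monom2 (a p) p) - x \<in> nhd0 (\<lambda>_. snd q + 1) (fst q + 1)"
    unfolding eventually_finite_subsets_at_top by blast
  have "coeff2 x q = prod_coeff a F' q" if "finite F' \<and> F \<subseteq> F' \<and> F' \<subseteq> I" for F'
  proof -
    have "coeff2 ((\<Prod>p\<in>F'. 1 - monom2 (a p) p) - x) q = 0"
      using F(3)[OF that] unfolding nhd0_def coeff2_def by auto
    then show ?thesis using that by (simp add: coeff2_finite_prod)
  qed
  with F(1,2) show ?thesis by blast
qed

text \<open>The coefficients seen by a basic neighbourhood must be determined by finitely many factors. This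
is Cauchy's criterion for the net of finite products, phrased as a finiteness property of exponents.\<close>

definition admissible :: "(int \<times> int \<Rightarrow> 'r::comm_ring_1) \<Rightarrow> (int \<times> int) set \<Rightarrow> bool" where
  "admissible a I \<longleftrightarrow> (\<forall>N m. \<exists>K. finite K \<and>
     (\<forall>S. finite S \<longrightarrow> S \<subseteq> I \<longrightarrow> (\<Prod>p\<in>S. - a p) \<noteq> 0 \<longrightarrow> fst (\<Sum>S) < N \<longrightarrow>
        snd (\<Sum>S) < m (fst (\<Sum>S)) \<longrightarrow> S \<subseteq> K))"

text \<open>Admissibility bounds the support of the candidate coefficients as a Laurent series requires. If the
exponents \<open>i\<close> of \<open>t\<close> were unbounded below, one could choose for each of these \<open>i\<close> a bound \<open>m i\<close>
just above a nonzero coefficient, and the finite set that belongs to \<open>m\<close> would be infinite.\<close>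

lemma has_prod2_exists:
  fixes a :: "int \<times> int \<Rightarrow> 'r::comm_ring_1"
  assumes adm: "admissible a I"
  shows "\<exists>x. has_prod2 a I x \<and> (\<forall>q. coeff2 x q = prod_coeff a I q)"
proof -
  have fin: "finite {q. prod_coeff a I q \<noteq> 0 \<and> fst q < N \<and> snd q < m (fst q)}" for N m
  proof -
    obtain K where K: "finite K" "\<forall>S. finite S \<longrightarrow> S \<subseteq> I \<longrightarrow> (\<Prod>p\<in>S. - a p) \<noteq> 0 \<longrightarrow>
        fst (\<Sum>S) < N \<longrightarrow> snd (\<Sum>S) < m (fst (\<Sum>S)) \<longrightarrow> S \<subseteq> K"
      using adm[unfolded admissible_def, rule_format, of N m] by blast
    have "q \<in> Sum ` Pow K" if "prod_coeff a I q \<noteq> 0" "fst q < N" "snd q < m (fst q)" for q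
    proof -
      obtain S where "finite S" "S \<subseteq> I" "(\<Prod>p\<in>S. - a p) \<noteq> 0" "\<Sum>S = q"
        using \<open>prod_coeff a I q \<noteq> 0\<close> unfolding prod_coeff_def
        by (rule sum.not_neutral_contains_not_neutral) auto
      then show ?thesis using K(2) that by blast
    qed
    then have "{q. prod_coeff a I q \<noteq> 0 \<and> fst q < N \<and> snd q < m (fst q)} \<subseteq> Sum ` Pow K" by blast
    then show ?thesis by (rule finite_subset) (use K(1) in simp)
  qed
  have "\<exists>n. \<forall>i j. i < n \<longrightarrow> prod_coeff a I (i, j) = 0"
  proof -
    \<comment> \<open>The bound \<open>m i\<close> lies just above some nonzero coefficient in the row \<open>i\<close>, if there is one.\<close>
    define m where "m i = (SOME j. prod_coeff a I (i, j) \<noteq> 0) + 1" for i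
    define X where "X = {q. prod_coeff a I q \<noteq> 0 \<and> fst q < 0 \<and> snd q < m (fst q)}"
    have "finite (fst ` X)" using fin[of 0 m] unfolding X_def by blast
    then have "bdd_below (fst ` X)" by (rule bdd_below_finite)
    then obtain n where n: "\<And>i. i \<in> fst ` X \<Longrightarrow> n \<le> i"
      unfolding bdd_below_def by blast
    have "prod_coeff a I (i, j) = 0" if "i < min n 0" for i j
    proof (rule ccontr)
      assume "prod_coeff a I (i, j) \<noteq> 0"
      then have "prod_coeff a I (i, m i - 1) \<noteq> 0"
        unfolding m_def by (simp, rule someI)
      with that have "(i, m i - 1) \<in> X" unfolding X_def by simp
      then have "i \<in> fst ` X" by force
      with n that show False by force
    qed
    then show ?thesis by blast
  qed
  moreover have "\<forall>i. \<exists>b. \<forall>j<b. prod_coeff a I (i, j) = 0"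
  proof
    fix i
    define X where "X = {q. prod_coeff a I q \<noteq> 0 \<and> fst q < i + 1 \<and> snd q < 0}"
    have "finite (snd ` X)" using fin[of "i + 1" "\<lambda>_. 0"] unfolding X_def by blast
    then have "bdd_below (snd ` X)" by (rule bdd_below_finite)
    then obtain n where n: "\<And>j. j \<in> snd ` X \<Longrightarrow> n \<le> j"
      unfolding bdd_below_def by blast
    have "prod_coeff a I (i, j) = 0" if "j < min n 0" for j
    proof (rule ccontr)
      assume "prod_coeff a I (i, j) \<noteq> 0"
      with that have "(i, j) \<in> X" unfolding X_def by simp
      then have "j \<in> snd ` X" by force
      with n that show False by force
    qed
    then show "\<exists>b. \<forall>j<b. prod_coeff a I (i, j) = 0" by blast
  qed
  ultimately obtain x where x: "\<And>q. coeff2 x q = prod_coeff a I q"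
    using series_with_coeffs_exists[of _ "prod_coeff a I"] by (metis (no_types))
  have "has_prod2 a I x"
    unfolding has_prod2_def
  proof (intro allI)
    fix m :: "int \<Rightarrow> int" and N
    obtain K where K: "finite K" "\<forall>S. finite S \<longrightarrow> S \<subseteq> I \<longrightarrow> (\<Prod>p\<in>S. - a p) \<noteq> 0 \<longrightarrow>
        fst (\<Sum>S) < N \<longrightarrow> snd (\<Sum>S) < m (fst (\<Sum>S)) \<longrightarrow> S \<subseteq> K"
      using adm[unfolded admissible_def, rule_format, of N m] by blast
    have "(\<Prod>p\<in>F. 1 - monom2 (a p) p) - x \<in> nhd0 m N"
      if F: "finite F" "K \<inter> I \<subseteq> F" "F \<subseteq> I" for F
      unfolding nhd0_def
    proof safe
      fix i j assume ij: "i < N" "j < m i"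
      have "prod_coeff a I (i, j) = prod_coeff a F (i, j)"
      proof (rule prod_coeff_cong)
        show "S \<subseteq> K" if "finite S" "S \<subseteq> I" "(\<Prod>p\<in>S. - a p) \<noteq> 0" "\<Sum>S = (i, j)" for S
          using K(2) that ij by simp
      qed (use F in auto)
      then have "coeff2 ((\<Prod>p\<in>F. 1 - monom2 (a p) p) - x) (i, j) = 0"
        using F(1) by (simp add: coeff2_finite_prod x)
      then show "((\<Prod>p\<in>F. 1 - monom2 (a p) p) - x) $$ i $$ j = 0"
        by (simp add: coeff2_def)
    qed
    then show "eventually (\<lambda>F. (\<Prod>p\<in>F. 1 - monom2 (a p) p) - x \<in> nhd0 m N)
        (finite_subsets_at_top I)"
      unfolding eventually_finite_subsets_at_top using K(1) by (intro exI[of _ "K \<inter> I"]) auto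
  qed
  with x show ?thesis by blast
qed

text \<open>Each of at most \<open>n\<close> summands pulls the sum down by at most \<open>b\<close>, so a single summand exceeds the sum
by at most \<open>n b\<close>.\<close>

lemma sum_bounds_of_bounded_below:
  fixes w :: "'a \<Rightarrow> int"
  assumes "finite S" "\<And>p. p \<in> S \<Longrightarrow> - b \<le> w p" "0 \<le> b" "card S \<le> n"
  shows "- (int n * b) \<le> sum w S" "p \<in> S \<Longrightarrow> w p \<le> sum w S + int n * b"
proof -
  have *: "- (int n * b) \<le> sum w T" if "T \<subseteq> S" for T
  proof -
    have "card T \<le> n" using card_mono[OF assms(1) that] assms(4) by simp
    then have "int (card T) * b \<le> int n * b" using assms(3) by (intro mult_right_mono) auto
    moreover have "int (card T) * (- b) \<le> sum w T"
      using assms(2) that by (intro sum_bounded_below) auto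
    ultimately show ?thesis by simp
  qed
  show "- (int n * b) \<le> sum w S" by (rule *) simp
  show "w p \<le> sum w S + int n * b" if "p \<in> S"
    using *[of "S - {p}"] sum.remove[OF assms(1) that, of w] by simp
qed

lemma fst_Sum: "fst (\<Sum>S) = (\<Sum>p\<in>S. fst p)" and snd_Sum: "snd (\<Sum>S) = (\<Sum>p\<in>S. snd p)"
  for S :: "(int \<times> int) set"
  by (simp_all add: fst_sum snd_sum)

text \<open>A nonzero product of coefficients divisible by \<open>e\<close> has at most \<open>n\<close> factors. The support of a
Laurent series is bounded below in \<open>i\<close>, and in \<open>j\<close> for each \<open>i\<close>. When the sum of at most \<open>n\<close>
exponents from it is bounded above, so is each of them, first in \<open>i\<close> and then in \<open>j\<close>.\<close>

lemma admissible_nilpotent: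
  fixes e :: "'r::comm_ring_1"
  assumes e: "e ^ n = 0" "\<And>p. e dvd coeff2 x p"
  shows "admissible (\<lambda>p. - coeff2 x p) I"
  unfolding admissible_def minus_minus
proof (intro allI)
  fix N :: int and m :: "int \<Rightarrow> int"
  obtain n0 \<beta> where n0: "\<forall>i<n0. \<forall>j. coeff2 x (i, j) = 0"
    and \<beta>: "\<forall>i. \<forall>j<\<beta> i. coeff2 x (i, j) = 0"
    using coeff2_bounds by blast
  \<comment> \<open>A lower bound for the powers of \<open>t\<close>; \<open>U\<close> bounds them above, and \<open>B\<close>, \<open>C\<close> do the same for \<open>u\<close>.\<close>
  define b where "b = max 0 (- n0)"
  define U where "U = N + int n * b"
  define B where "B = (\<Sum>i\<in>{-b..U}. \<bar>\<beta> i\<bar>)"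
  define C where "C = (\<Sum>i\<in>{-(int n * b)..N}. \<bar>m i\<bar>)"
  have B: "- B \<le> \<beta> i" if "- b \<le> i" "i \<le> U" for i
    using member_le_sum[of i "{-b..U}" "\<lambda>i. \<bar>\<beta> i\<bar>"] that unfolding B_def by auto
  have C: "m i \<le> C" if "- (int n * b) \<le> i" "i \<le> N" for i
    using member_le_sum[of i "{-(int n * b)..N}" "\<lambda>i. \<bar>m i\<bar>"] that unfolding C_def by auto
  have nonneg: "0 \<le> b" "0 \<le> B" unfolding b_def B_def by (auto intro: sum_nonneg)
  have "S \<subseteq> {-b..U} \<times> {-B..C + int n * B}"
    if S: "finite S" "(\<Prod>p\<in>S. coeff2 x p) \<noteq> 0" "fst (\<Sum>S) < N" "snd (\<Sum>S) < m (fst (\<Sum>S))" for S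
  proof -
    have "e ^ card S dvd (\<Prod>p\<in>S. coeff2 x p)"
      using prod_dvd_prod[of S "\<lambda>_. e" "coeff2 x"] e(2) by simp
    with S(2) have "e ^ card S \<noteq> 0" by auto
    then have card: "card S \<le> n"
      using e(1) by (metis le_add_diff_inverse mult_zero_left nle_le power_add)
    have nz: "coeff2 x p \<noteq> 0" if "p \<in> S" for p
      using S(1,2) that by (meson prod_zero)
    have fstb: "- b \<le> fst p" if "p \<in> S" for p
      using n0[rule_format, of "fst p" "snd p"] nz[OF that] unfolding b_def by force
    have U: "fst p \<le> U" if "p \<in> S" for p
      using sum_bounds_of_bounded_below(2)[of S b fst, OF S(1) fstb nonneg(1) card that] S(3)
      unfolding fst_Sum U_def by simp
    have sndb: "- B \<le> snd p" if "p \<in> S" for p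
    proof -
      have "\<beta> (fst p) \<le> snd p" using \<beta>[rule_format, of "snd p" "fst p"] nz[OF that] by force
      with B[of "fst p"] fstb[OF that] U[OF that] show ?thesis by simp
    qed
    have "- (int n * b) \<le> fst (\<Sum>S)"
      using sum_bounds_of_bounded_below(1)[of S b fst, OF S(1) fstb nonneg(1) card] unfolding fst_Sum .
    with C[of "fst (\<Sum>S)"] S(3,4) have "snd (\<Sum>S) \<le> C" by simp
    then have "snd p \<le> C + int n * B" if "p \<in> S" for p
      using sum_bounds_of_bounded_below(2)[of S B snd, OF S(1) sndb nonneg(2) card that]
      unfolding snd_Sum by simp
    with fstb U sndb show ?thesis by fastforce
  qed
  then show "\<exists>K. finite K \<and>
     (\<forall>S. finite S \<longrightarrow> S \<subseteq> I \<longrightarrow> (\<Prod>p\<in>S. coeff2 x p) \<noteq> 0 \<longrightarrow> fst (\<Sum>S) < N \<longrightarrow>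
        snd (\<Sum>S) < m (fst (\<Sum>S)) \<longrightarrow> S \<subseteq> K)"
    by (intro exI[of _ "{-b..U} \<times> {-B..C + int n * B}"]) auto
qed

section \<open>Series with divisible coefficients\<close>

text \<open>This is the ideal of series that vanish modulo \<open>e\<close>. Working with it replaces the passage to
coefficientwise quotient rings.\<close>

definition coeffs_dvd :: "'r::comm_ring_1 \<Rightarrow> 'r fls fls \<Rightarrow> bool" where
  "coeffs_dvd e x \<longleftrightarrow> (\<forall>p. e dvd coeff2 x p)"

lemma coeffs_dvd_add: "coeffs_dvd e x \<Longrightarrow> coeffs_dvd e y \<Longrightarrow> coeffs_dvd e (x + y)"
  and coeffs_dvd_diff: "coeffs_dvd e x \<Longrightarrow> coeffs_dvd e y \<Longrightarrow> coeffs_dvd e (x - y)"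
  and coeffs_dvd_0: "coeffs_dvd e 0"
  by (simp_all add: coeffs_dvd_def)

lemma coeffs_dvd_trans: "d dvd e \<Longrightarrow> coeffs_dvd e x \<Longrightarrow> coeffs_dvd d x"
  by (auto simp: coeffs_dvd_def intro: dvd_trans)

lemma coeffs_dvd_mult: "coeffs_dvd d x \<Longrightarrow> coeffs_dvd e y \<Longrightarrow> coeffs_dvd (d * e) (x * y)"
  unfolding coeffs_dvd_def coeff2_mult(2) by (intro allI dvd_sum mult_dvd_mono) auto

lemma coeffs_dvd_mult_left: "coeffs_dvd e y \<Longrightarrow> coeffs_dvd e (x * y)"
  using coeffs_dvd_mult[of 1 x e y] by (simp add: coeffs_dvd_def)

lemma coeffs_dvd_mult_right: "coeffs_dvd e x \<Longrightarrow> coeffs_dvd e (x * y)"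
  using coeffs_dvd_mult[of e x 1 y] by (simp add: coeffs_dvd_def)

lemma coeffs_dvd_monom2: "e dvd c \<Longrightarrow> coeffs_dvd e (monom2 c p)"
  by (simp add: coeffs_dvd_def coeff2_monom2)

lemma coeffs_dvd_sum: "(\<And>x. x \<in> A \<Longrightarrow> coeffs_dvd e (f x)) \<Longrightarrow> coeffs_dvd e (\<Sum>x\<in>A. f x)"
  by (induction A rule: infinite_finite_induct) (auto intro: coeffs_dvd_add coeffs_dvd_0)

lemma coeffs_dvd_power: "coeffs_dvd e x \<Longrightarrow> coeffs_dvd (e ^ n) (x ^ n)"
proof (induction n)
  case (Suc n)
  then show ?case using coeffs_dvd_mult[of e x "e ^ n" "x ^ n"] by simp
qed (simp add: coeffs_dvd_def)

lemma coeffs_dvd_zeroD: "coeffs_dvd 0 x \<Longrightarrow> x = 0"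
proof (rule coeff2_eqI)
  fix p assume "coeffs_dvd 0 x"
  then have "0 dvd coeff2 x p" unfolding coeffs_dvd_def by blast
  then show "coeff2 x p = coeff2 0 p" by simp
qed

section \<open>Perturbation of infinite products\<close>

lemma finite_prod_near_1:
  assumes "finite F" "\<And>p. p \<in> F \<Longrightarrow> e dvd a p"
  shows "coeffs_dvd e ((\<Prod>p\<in>F. 1 - monom2 (a p) p) - 1)"
  using assms
proof (induction F)
  case (insert p F)
  let ?P = "\<Prod>p\<in>F. 1 - monom2 (a p) p"
  have "(\<Prod>p\<in>insert p F. 1 - monom2 (a p) p) - 1 = (?P - 1) - monom2 (a p) p * ?P"
    using insert.hyps by (simp add: algebra_simps)
  also have "coeffs_dvd e \<dots>"
    by (rule coeffs_dvd_diff[OF insert.IH coeffs_dvd_mult_right[OF coeffs_dvd_monom2]])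
      (use insert.prems in blast)+
  finally show ?case .
qed (simp add: coeffs_dvd_0)

text \<open>Changing factors that are \<open>1\<close> modulo \<open>e\<close> by multiples of \<open>e\<^sup>n\<close> changes the product, up to
\<open>e\<^sup>n\<^sup>+\<^sup>1\<close>, by the sum of the changes: every other term of the expansion contains a further factor
that is divisible by \<open>e\<close>.\<close>

lemma finite_prod_perturb:
  assumes "finite F" "\<And>p. p \<in> F \<Longrightarrow> e dvd a p" "\<And>p. p \<in> F \<Longrightarrow> e ^ n dvd a' p - a p" "n \<ge> 1"
  shows "coeffs_dvd (e ^ Suc n)
    ((\<Prod>p\<in>F. 1 - monom2 (a' p) p) - (\<Prod>p\<in>F. 1 - monom2 (a p) p) + (\<Sum>p\<in>F. monom2 (a' p - a p) p))"
  using assms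
proof (induction F)
  case (insert p F)
  let ?P = "\<Prod>p\<in>F. 1 - monom2 (a p) p" and ?P' = "\<Prod>p\<in>F. 1 - monom2 (a' p) p"
  let ?S = "\<Sum>p\<in>F. monom2 (a' p - a p) p" and ?m = "monom2 (a p) p" and ?m' = "monom2 (a' p) p"
  have diff: "monom2 (a' p - a p) p = ?m' - ?m"
    by (rule coeff2_eqI) (simp add: coeff2_monom2)
  have "e dvd e ^ n" using \<open>n \<ge> 1\<close> by (intro dvd_power) auto
  then have "e dvd a' p - a p"
    using insert.prems(2) dvd_trans by blast
  then have "e dvd a' p - a p + a p"
    using insert.prems(1) by (intro dvd_add) blast+
  then have m': "coeffs_dvd e ?m'" by (intro coeffs_dvd_monom2) simp
  have IH: "coeffs_dvd (e ^ Suc n) (?P' - ?P + ?S)" using insert by simp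
  have "coeffs_dvd (e ^ n) ((?P' - ?P + ?S) - ?S)"
    using insert.prems by (intro coeffs_dvd_diff coeffs_dvd_sum coeffs_dvd_monom2 coeffs_dvd_trans[OF _ IH]) auto
  then have "coeffs_dvd (e * e ^ n) (?m' * (?P' - ?P))"
    using m' by (intro coeffs_dvd_mult) auto
  moreover have "coeffs_dvd (e ^ n * e) ((?m' - ?m) * (?P - 1))"
  proof (rule coeffs_dvd_mult)
    show "coeffs_dvd (e ^ n) (?m' - ?m)"
      unfolding diff[symmetric] using insert.prems(2) by (intro coeffs_dvd_monom2) blast
    show "coeffs_dvd e (?P - 1)"
      by (rule finite_prod_near_1[OF insert.hyps(1)]) (rule insert.prems(1), simp)
  qed
  ultimately have "coeffs_dvd (e ^ Suc n) ((?P' - ?P + ?S) - ?m' * (?P' - ?P) - (?m' - ?m) * (?P - 1))"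
    using IH by (intro coeffs_dvd_diff) (auto simp: mult.commute)
  \<comment> \<open>Both correction terms have order \<open>n + 1\<close>: one factor has order \<open>n\<close> and the other order \<open>1\<close>.\<close>
  also have "(?P' - ?P + ?S) - ?m' * (?P' - ?P) - (?m' - ?m) * (?P - 1) =
     (1 - ?m') * ?P' - (1 - ?m) * ?P + (monom2 (a' p - a p) p + ?S)"
    unfolding diff by (simp add: algebra_simps)
  finally show ?case using insert.hyps by simp
qed (simp add: coeffs_dvd_0)

lemma has_prod2_perturb:
  assumes "has_prod2 a I x" "has_prod2 a' I x'"
    "\<And>p. p \<in> I \<Longrightarrow> e dvd a p" "\<And>p. p \<in> I \<Longrightarrow> e ^ n dvd a' p - a p" "n \<ge> 1"
  shows "e ^ Suc n dvd coeff2 x' q - coeff2 x q + (if q \<in> I then a' q - a q else 0)"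
proof -
  obtain F where F: "finite F" "F \<subseteq> I"
    "\<forall>F'. finite F' \<and> F \<subseteq> F' \<and> F' \<subseteq> I \<longrightarrow> coeff2 x q = prod_coeff a F' q"
    using has_prod2_finite_coeff[OF assms(1), of q] by auto
  obtain G where G: "finite G" "G \<subseteq> I"
    "\<forall>F'. finite F' \<and> G \<subseteq> F' \<and> F' \<subseteq> I \<longrightarrow> coeff2 x' q = prod_coeff a' F' q"
    using has_prod2_finite_coeff[OF assms(2), of q] by auto
  define H where "H = F \<union> G \<union> ({q} \<inter> I)"
  have H: "finite H" "H \<subseteq> I" "q \<in> H \<longleftrightarrow> q \<in> I" and FH: "F \<subseteq> H" "G \<subseteq> H"
      unfolding H_def using F(1,2) G(1,2) by auto
  have "coeffs_dvd (e ^ Suc n)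
    ((\<Prod>p\<in>H. 1 - monom2 (a' p) p) - (\<Prod>p\<in>H. 1 - monom2 (a p) p) + (\<Sum>p\<in>H. monom2 (a' p - a p) p))"
    by (rule finite_prod_perturb[OF H(1) _ _ assms(5)]) (use assms(3,4) H(2) in blast)+
  then have "e ^ Suc n dvd prod_coeff a' H q - prod_coeff a H q
       + (\<Sum>p\<in>H. if q = p then a' p - a p else 0)"
    unfolding coeffs_dvd_def coeff2_arith coeff2_finite_prod[OF H(1)] coeff2_sum coeff2_monom2 ..
  also have "(\<Sum>p\<in>H. if q = p then a' p - a p else 0) = (if q \<in> I then a' q - a q else 0)"
    using H(1,3) by simp
  also have "prod_coeff a H q = coeff2 x q"
    using F(3)[rule_format, of H] FH(1) H(1,2) by simp
  also have "prod_coeff a' H q = coeff2 x' q"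
    using G(3)[rule_format, of H] FH(2) H(1,2) by simp
  finally show ?thesis .
qed

lemma has_prod2_0: "has_prod2 (\<lambda>_. 0) I (1 :: 'r::comm_ring_1 fls fls)"
  unfolding has_prod2_def by (intro allI always_eventually) (simp add: nhd0_def)

text \<open>The perturbation of the trivial product \<open>1\<close>, with \<open>n = 1\<close>.\<close>

lemma has_prod2_first_order:
  assumes "has_prod2 a I x" "\<And>p. p \<in> I \<Longrightarrow> e dvd a p"
  shows "e ^ 2 dvd coeff2 (x - 1) q + (if q \<in> I then a q else 0)"
proof -
  have "e ^ Suc 1 dvd coeff2 x q - coeff2 1 q + (if q \<in> I then a q - 0 else 0)"
    by (rule has_prod2_perturb[OF has_prod2_0 assms(1)]) (use assms(2) in simp_all)
  then show ?thesis unfolding numeral_2_eq_2 One_nat_def coeff2_arith diff_zero .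
qed

lemma has_prod2_near_1:
  assumes "has_prod2 a I x" "\<And>p. p \<in> I \<Longrightarrow> e dvd a p"
  shows "coeffs_dvd e (x - 1)"
  unfolding coeffs_dvd_def
proof
  fix q
  let ?c = "if q \<in> I then a q else 0"
  have "e dvd e ^ 2" by simp
  then have "e dvd (coeff2 (x - 1) q + ?c) - ?c"
    using has_prod2_first_order[OF assms, of q] assms(2)
    by (intro dvd_diff) (rule dvd_trans, assumption, assumption, simp)
  then show "e dvd coeff2 (x - 1) q" by (simp only: add_diff_cancel_right')
qed

section \<open>Exponents of a product and the splitting of the lattice\<close>

lemma Sum_closed:
  fixes I :: "(int \<times> int) set"
  assumes "finite S" "S \<noteq> {}" "S \<subseteq> I" "\<And>p q. p \<in> I \<Longrightarrow> q \<in> I \<Longrightarrow> p + q \<in> I"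
  shows "\<Sum>S \<in> I"
  using assms(1-3) by (induction S rule: finite_ne_induct) (auto intro: assms(4))

lemma prod_coeff_outside:
  fixes I :: "(int \<times> int) set"
  assumes "\<And>p q. p \<in> I \<Longrightarrow> q \<in> I \<Longrightarrow> p + q \<in> I" "F \<subseteq> I" "q \<notin> I"
  shows "prod_coeff a F q = (if q = 0 then 1 else 0)"
proof -
  have "S = {}" if "finite S" "S \<subseteq> F" "\<Sum>S = q" for S
  proof (rule ccontr)
    assume "S \<noteq> {}"
    then have "\<Sum>S \<in> I"
      using that(1,2) assms(1,2) by (intro Sum_closed) (simp, simp, blast, blast)
    with that(3) assms(3) show False by simp
  qed
  then have "{S. finite S \<and> S \<subseteq> F \<and> (\<Prod>p\<in>S. - a p) \<noteq> 0 \<and> \<Sum>S = q}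
      \<subseteq> (if q = 0 then {{}} else {})"
    by (cases "q = 0") fastforce+
  moreover have "(if q = 0 then {{}} else {})
      \<subseteq> {S. finite S \<and> S \<subseteq> F \<and> (\<Prod>p\<in>S. - a p) \<noteq> 0 \<and> \<Sum>S = q}"
    by simp
  ultimately have "{S. finite S \<and> S \<subseteq> F \<and> (\<Prod>p\<in>S. - a p) \<noteq> 0 \<and> \<Sum>S = q} = (if q = 0 then {{}} else {})"
    by (rule equalityI)
  then show ?thesis by (simp add: prod_coeff_def)
qed

lemma supp2_has_prod2:
  assumes "has_prod2 a I x" "\<And>p q. p \<in> I \<Longrightarrow> q \<in> I \<Longrightarrow> p + q \<in> I"
  shows "supp2 (x - 1) \<subseteq> I"
proof -
  have "coeff2 (x - 1) q = 0" if "q \<notin> I" for q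
  proof -
    obtain F where "finite F" "F \<subseteq> I" "coeff2 x q = prod_coeff a F q"
      using has_prod2_finite_coeff[OF assms(1), of q] by blast
    then have "coeff2 x q = (if q = 0 then 1 else 0)"
      using prod_coeff_outside[OF assms(2) _ that] by metis
    then show ?thesis by (simp add: coeff2_1)
  qed
  then show ?thesis by (fastforce simp: supp2_def coeff2_def)
qed

abbreviation pos_exps :: "(int \<times> int) set" where "pos_exps \<equiv> {(0, 1)..}"
abbreviation neg_exps :: "(int \<times> int) set" where "neg_exps \<equiv> {..(0, -1)}"

lemma pos_exps_iff: "p \<in> pos_exps \<longleftrightarrow> 0 < p" and neg_exps_iff: "p \<in> neg_exps \<longleftrightarrow> p < 0"
  for p :: "int \<times> int"
  by (cases p; auto simp: zero_prod_def)+

lemma exps_add: "p \<in> pos_exps \<Longrightarrow> q \<in> pos_exps \<Longrightarrow> p + q \<in> pos_exps"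
  "p \<in> neg_exps \<Longrightarrow> q \<in> neg_exps \<Longrightarrow> p + q \<in> neg_exps" for p q :: "int \<times> int"
  by (cases p; cases q; auto)+

section \<open>Factorization of a unit near 1\<close>

text \<open>Successive approximation along the powers of \<open>e\<close>. The factorization is sought in the form
given by a series \<open>A\<close>, whose coefficient
\<open>A\<^sub>p\<close> provides the factor \<open>1 + A\<^sub>p u\<^sup>jt\<^sup>i\<close> for \<open>p \<noteq> 0\<close> and the constant \<open>1 + A\<^sub>0\<close>. If the error
\<open>D\<close> is divisible by \<open>e\<^sup>n\<close>, then by the perturbation lemma passing from \<open>A\<close> to \<open>A + D\<close> changes the
product by \<open>D\<close> modulo \<open>e\<^sup>n\<^sup>+\<^sup>1\<close>, so the new error is divisible by \<open>e\<^sup>n\<^sup>+\<^sup>1\<close>. Encoding the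
parameters as a series keeps their support inside the support of a Laurent series.\<close>

lemma nilpotent_factorization_exists:
  fixes e :: "'r::comm_ring_1"
  assumes nil: "e ^ N = 0" and f: "coeffs_dvd e (f - 1)"
  shows "\<exists>A X Y. coeffs_dvd e A \<and> has_prod2 (\<lambda>p. - coeff2 A p) neg_exps X \<and>
    has_prod2 (\<lambda>p. - coeff2 A p) pos_exps Y \<and> f = X * const2 (1 + coeff2 A 0) * Y"
proof -
  have ex: "\<exists>x. has_prod2 (\<lambda>p. - coeff2 A p) I x" if "coeffs_dvd e A" for A I
    using has_prod2_exists[OF admissible_nilpotent[OF nil]] that unfolding coeffs_dvd_def by blast
  have "\<exists>A X Y. coeffs_dvd e A \<and> has_prod2 (\<lambda>p. - coeff2 A p) neg_exps X \<and>
    has_prod2 (\<lambda>p. - coeff2 A p) pos_exps Y \<and>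
    coeffs_dvd (e ^ n) (f - X * const2 (1 + coeff2 A 0) * Y)" if "n \<ge> 1" for n
    using that
  proof (induction n rule: dec_induct)
    case base
    have "const2 (1::'r) = 1" by (rule coeff2_eqI) (simp add: coeff2_const2 coeff2_1)
    then show ?case
      using f has_prod2_0 by (intro exI[of _ 0] exI[of _ 1]) (auto simp: coeffs_dvd_0)
  next
    case (step n)
    then obtain A X Y where A: "coeffs_dvd e A" "has_prod2 (\<lambda>p. - coeff2 A p) neg_exps X"
      "has_prod2 (\<lambda>p. - coeff2 A p) pos_exps Y"
      and *: "coeffs_dvd (e ^ n) (f - X * const2 (1 + coeff2 A 0) * Y)" by blast
    define D where "D = f - X * const2 (1 + coeff2 A 0) * Y"
    have D: "coeffs_dvd (e ^ n) D" using * unfolding D_def .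
    have en: "e dvd e ^ n" using step.hyps by (intro dvd_power) auto
    have AD: "coeffs_dvd e (A + D)" 
      using A(1) coeffs_dvd_trans[OF en D] by (rule coeffs_dvd_add)
    then obtain X' Y' where X': "has_prod2 (\<lambda>p. - coeff2 (A + D) p) neg_exps X'"
      and Y': "has_prod2 (\<lambda>p. - coeff2 (A + D) p) pos_exps Y'" using ex by meson
    have pert: "\<exists>D'. (\<forall>p. coeff2 D' p = (if p \<in> I then coeff2 D p else 0)) \<and>
        coeffs_dvd (e ^ n) D' \<and> coeffs_dvd (e ^ Suc n) (Z' - Z - D')"
      if Z: "has_prod2 (\<lambda>p. - coeff2 A p) I Z" and Z': "has_prod2 (\<lambda>p. - coeff2 (A + D) p) I Z'"
      for I Z Z'
    proof -
      obtain D' where D': "\<forall>p. coeff2 D' p = (if p \<in> I then coeff2 D p else 0)"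
        using series_restrict_exists by blast
      have "e ^ Suc n dvd coeff2 Z' q - coeff2 Z q
          + (if q \<in> I then - coeff2 (A + D) q - - coeff2 A q else 0)" for q
        by (rule has_prod2_perturb[OF Z Z'])
          (use A(1) D step.hyps in \<open>auto simp: coeffs_dvd_def\<close>)
      then have "coeffs_dvd (e ^ Suc n) (Z' - Z - D')"
        unfolding coeffs_dvd_def coeff2_arith D'[rule_format]
      proof (intro allI)
        fix q
        have "coeff2 Z' q - coeff2 Z q + (if q \<in> I then - (coeff2 A q + coeff2 D q) - - coeff2 A q else 0)
            = coeff2 Z' q - coeff2 Z q - (if q \<in> I then coeff2 D q else 0)" by simp
        with \<open>\<And>q. e ^ Suc n dvd coeff2 Z' q - coeff2 Z q
            + (if q \<in> I then - coeff2 (A + D) q - - coeff2 A q else 0)\<close>[of q]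
        show "e ^ Suc n dvd coeff2 Z' q - coeff2 Z q - (if q \<in> I then coeff2 D q else 0)"
          unfolding coeff2_arith by (simp only:)
      qed
      moreover have "coeffs_dvd (e ^ n) D'" using D D' by (simp add: coeffs_dvd_def)
      ultimately show ?thesis using D' by blast
    qed
    obtain Dn where Dn: "\<forall>p. coeff2 Dn p = (if p \<in> neg_exps then coeff2 D p else 0)"
      "coeffs_dvd (e ^ n) Dn" "coeffs_dvd (e ^ Suc n) (X' - X - Dn)" using pert[OF A(2) X'] by blast
    obtain Dp where Dp: "\<forall>p. coeff2 Dp p = (if p \<in> pos_exps then coeff2 D p else 0)"
      "coeffs_dvd (e ^ n) Dp" "coeffs_dvd (e ^ Suc n) (Y' - Y - Dp)" using pert[OF A(3) Y'] by blast
    define c where "c = const2 (1 + coeff2 A 0)"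
    define d where "d = const2 (coeff2 D 0)"
    have c': "const2 (1 + coeff2 (A + D) 0) = c + d"
      by (rule coeff2_eqI) (simp add: c_def d_def coeff2_const2)
    have D_split: "D = Dn + d + Dp"
    proof (rule coeff2_eqI)
      fix p :: "int \<times> int"
      have "p < 0 \<or> p = 0 \<or> 0 < p" "\<not> (p < 0 \<and> 0 < p)" by auto
      then show "coeff2 D p = coeff2 (Dn + d + Dp) p"
        unfolding coeff2_arith Dn(1)[rule_format] Dp(1)[rule_format] d_def coeff2_const2
          pos_exps_iff neg_exps_iff by auto
    qed
    have d: "coeffs_dvd (e ^ n) d" 
      using D unfolding coeffs_dvd_def d_def coeff2_const2 by simp
    have near: "coeffs_dvd e (X - 1)" "coeffs_dvd e (Y' - 1)" "coeffs_dvd e (c - 1)" "coeffs_dvd e d"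
    proof -
      show "coeffs_dvd e (X - 1)"
        by (rule has_prod2_near_1[OF A(2)]) (use A(1) in \<open>simp add: coeffs_dvd_def\<close>)
      show "coeffs_dvd e (Y' - 1)"
        by (rule has_prod2_near_1[OF Y']) (use AD in \<open>simp only: coeffs_dvd_def dvd_minus_iff\<close>)
      show "coeffs_dvd e (c - 1)"
        using A(1) unfolding coeffs_dvd_def c_def coeff2_const2 coeff2_1 coeff2_arith by simp
      show "coeffs_dvd e d" using coeffs_dvd_trans[OF en d] .
    qed
    have mult_near: "coeffs_dvd e (x * y - 1)" if "coeffs_dvd e (x - 1)" "coeffs_dvd e (y - 1)" for x y
    proof -
      have "x * y - 1 = (x - 1) * y + (y - 1)" by (simp add: algebra_simps)
      also have "coeffs_dvd e \<dots>" using that by (intro coeffs_dvd_add coeffs_dvd_mult_right)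
      finally show ?thesis .
    qed
    have "(c + d) - 1 = (c - 1) + d" by simp
    with near have cd: "coeffs_dvd e ((c + d) - 1)" using coeffs_dvd_add by metis
    have small: "coeffs_dvd (e ^ Suc n) (x * (y - 1))" if "coeffs_dvd (e ^ n) x" "coeffs_dvd e (y - 1)" for x y
      using coeffs_dvd_mult[OF that] by (simp add: mult.commute)
    have "f - X' * (c + d) * Y' = D - (X' * (c + d) * Y' - X * c * Y)"
      by (simp add: D_def c_def)
    \<comment> \<open>Up to sign, the change of the product minus \<open>D\<close>, replacing one of its three factors at a time.\<close>
    also have "\<dots> = 0 - ((X' - X - Dn) * ((c + d) * Y') + Dn * ((c + d) * Y' - 1)
         + d * (X * Y' - 1) + X * c * (Y' - Y - Dp) + Dp * (X * c - 1))"
      unfolding D_split by (simp add: algebra_simps)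
    also have "coeffs_dvd (e ^ Suc n) \<dots>"
      by (intro coeffs_dvd_diff coeffs_dvd_0 coeffs_dvd_add coeffs_dvd_mult_right[OF Dn(3)] coeffs_dvd_mult_left[OF Dp(3)]
          small mult_near Dn(2) Dp(2) d cd near)
    finally show ?case using AD X' Y' c' by metis
  qed
  from this[of "Suc N"] obtain A X Y where "coeffs_dvd e A" "has_prod2 (\<lambda>p. - coeff2 A p) neg_exps X"
    "has_prod2 (\<lambda>p. - coeff2 A p) pos_exps Y" "coeffs_dvd (e ^ Suc N) (f - X * const2 (1 + coeff2 A 0) * Y)"
    by auto
  moreover from this nil have "f = X * const2 (1 + coeff2 A 0) * Y"
    using coeffs_dvd_zeroD[of "f - X * const2 (1 + coeff2 A 0) * Y"] by simp
  ultimately show ?thesis by blast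
qed

section \<open>Factorization of a positive unit\<close>

text \<open>The factors of an infinite product of positive exponents produce new exponents. They are confined to an
additively closed set \<open>J\<close> that still has the finiteness properties of the support of \<open>x\<close>. With \<open>M\<close>
nondecreasing and \<open>M i\<close> at least the pole orders in \<open>u\<close> of the first \<open>i\<close> coefficients, the region
\<open>j \<ge> - i M i\<close> is such a set. On the part with \<open>i \<le> N\<close> the weight \<open>j + i (M N + 1)\<close> is
nonnegative and additive, so a bound for a sum bounds every summand. The lexicographic order on all positive
exponents has infinite descents, for example \<open>(1, -j)\<close>, but on \<open>J\<close> it is well-founded.\<close>

lemma supp_has_pos_cone:
  fixes x :: "'r::zero fls fls"
  shows "\<exists>J \<subseteq> pos_exps. (\<forall>p\<in>pos_exps. coeff2 x p \<noteq> 0 \<longrightarrow> p \<in> J) \<and>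
    (\<forall>p\<in>J. \<forall>q\<in>J. p + q \<in> J) \<and> wf {(p, q). p \<in> J \<and> q \<in> J \<and> p < q} \<and>
    (\<forall>N m. \<exists>K. finite K \<and> (\<forall>S. finite S \<longrightarrow> S \<subseteq> J \<longrightarrow> fst (\<Sum>S) < N \<longrightarrow>
        snd (\<Sum>S) < m (fst (\<Sum>S)) \<longrightarrow> S \<subseteq> K))"
proof -
  define M where "M i = (\<Sum>l\<in>{1..i}. \<bar>fls_subdegree (x $$ l)\<bar>)" for i
  define J where "J = {p :: int \<times> int. 0 < p \<and> (0 < fst p \<longrightarrow> - (fst p * M (fst p)) \<le> snd p)}"
  have M_nonneg: "0 \<le> M i" for i unfolding M_def by (rule sum_nonneg) simp
  have M_mono: "M i \<le> M l" if "i \<le> l" for i l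
    unfolding M_def by (rule sum_mono2) (use that in auto)
  have J_fst: "0 \<le> fst p" and J_snd: "fst p = 0 \<Longrightarrow> 1 \<le> snd p" if "p \<in> J" for p
    using that unfolding J_def by (cases p; auto simp: zero_prod_def)+
  have "J \<subseteq> pos_exps" unfolding J_def pos_exps_iff subset_iff by simp
  moreover have "p \<in> J" if "p \<in> pos_exps" "coeff2 x p \<noteq> 0" for p
  proof -
    have "- (fst p * M (fst p)) \<le> snd p" if i: "0 < fst p"
    proof -
      have "fls_subdegree (x $$ fst p) \<le> snd p"
        using \<open>coeff2 x p \<noteq> 0\<close> fls_eq0_below_subdegree[of "snd p" "x $$ fst p"]
        unfolding coeff2_def by (cases "snd p < fls_subdegree (x $$ fst p)") auto
      moreover have "\<bar>fls_subdegree (x $$ fst p)\<bar> \<le> M (fst p)"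
        unfolding M_def using member_le_sum[of "fst p" "{1..fst p}" "\<lambda>l. \<bar>fls_subdegree (x $$ l)\<bar>"] i
        by simp
      moreover have "1 * M (fst p) \<le> fst p * M (fst p)"
        using i M_nonneg by (intro mult_right_mono) auto
      ultimately show ?thesis by linarith
    qed
    with that(1) show ?thesis unfolding J_def pos_exps_iff by simp
  qed
  moreover have "p + q \<in> J" if pq: "p \<in> J" "q \<in> J" for p q
  proof -
    define i k where "i = fst p" and "k = fst q"
    have nn: "0 \<le> i" "0 \<le> k" unfolding i_def k_def using J_fst pq by auto
    have low: "- (i * M (i + k)) \<le> snd p" "- (k * M (i + k)) \<le> snd q"
    proof -
      have "i * M i \<le> i * M (i + k)" "k * M k \<le> k * M (i + k)"
        using nn M_mono by (auto intro!: mult_left_mono)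
      moreover have "- (i * M i) \<le> snd p" "- (k * M k) \<le> snd q"
        using pq J_snd[OF pq(1)] J_snd[OF pq(2)] nn unfolding J_def i_def k_def by force+
      ultimately show "- (i * M (i + k)) \<le> snd p" "- (k * M (i + k)) \<le> snd q" by linarith+
    qed
    have "0 < p + q" using exps_add(1)[of p q] pq unfolding J_def pos_exps_iff by simp
    moreover have "- (fst (p + q) * M (fst (p + q))) \<le> snd (p + q)"
      using low by (simp add: i_def[symmetric] k_def[symmetric] algebra_simps)
    ultimately show ?thesis unfolding J_def by simp
  qed
  moreover have "wf {(p, q). p \<in> J \<and> q \<in> J \<and> p < q}"
  proof (rule wf_subset)
    \<comment> \<open>On \<open>J\<close> both components are nonnegative before the conversion to natural numbers.\<close>
    let ?m = "\<lambda>p :: int \<times> int. (nat (fst p), nat (snd p + fst p * M (fst p)))"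
    show "wf (inv_image (less_than <*lex*> less_than) ?m)"
      by (intro wf_inv_image wf_lex_prod wf_less_than)
    show "{(p, q). p \<in> J \<and> q \<in> J \<and> p < q} \<subseteq> inv_image (less_than <*lex*> less_than) ?m"
    proof safe
      fix i j k l assume pq: "(i, j) \<in> J" "(k, l) \<in> J" "(i, j) < (k, l)"
      show "((i, j), (k, l)) \<in> inv_image (less_than <*lex*> less_than) ?m"
      proof (cases "i < k")
        case True
        then show ?thesis using J_fst[OF pq(1)] by simp
      next
        case False
        with pq(3) have "i = k" "j < l" by auto
        moreover have "0 \<le> j + i * M i"
          using pq(1) J_snd[OF pq(1)] J_fst[OF pq(1)] unfolding J_def by (cases "i = 0") auto
        ultimately show ?thesis by auto
      qed
    qed
  qed
  moreover have "\<exists>K. finite K \<and> (\<forall>S. finite S \<longrightarrow> S \<subseteq> J \<longrightarrow> fst (\<Sum>S) < N \<longrightarrow>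
        snd (\<Sum>S) < m (fst (\<Sum>S)) \<longrightarrow> S \<subseteq> K)" for N and m :: "int \<Rightarrow> int"
  proof -
    define B where "B = (\<Sum>i\<in>{0..N}. \<bar>m i\<bar>)"
    define C where "C = B + N * (M N + 1)"
    have "S \<subseteq> {0..N} \<times> {- (N * (M N + 1))..C}"
      if S: "finite S" "S \<subseteq> J" "fst (\<Sum>S) < N" "snd (\<Sum>S) < m (fst (\<Sum>S))" for S
    proof
      fix p assume "p \<in> S"
      define w where "w q = snd q + fst q * (M N + 1)" for q
      have fst_le: "fst q \<le> fst (\<Sum>S)" if "q \<in> S" for q
        unfolding fst_Sum using S(1,2) J_fst that by (intro member_le_sum) auto
      have w_pos: "0 \<le> w q" if "q \<in> S" for q
      proof -
        have q: "q \<in> J" "0 \<le> fst q" using that S(2) J_fst[of q] by blast+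
        show ?thesis
        proof (cases "fst q = 0")
          case True
          then show ?thesis using J_snd[OF q(1)] by (simp add: w_def)
        next
          case False
          have "fst q * M (fst q) \<le> fst q * M N"
            using q(2) fst_le[OF that] S(3) by (intro mult_left_mono M_mono) auto
          moreover have "- (fst q * M (fst q)) \<le> snd q"
            using q False unfolding J_def by auto
          ultimately show ?thesis using q(2) by (simp add: w_def algebra_simps)
        qed
      qed
      have fst_nonneg: "0 \<le> fst (\<Sum>S)"
        unfolding fst_Sum using S(2) J_fst by (intro sum_nonneg) auto
      have "w p \<le> (\<Sum>q\<in>S. w q)"
        using S(1) \<open>p \<in> S\<close> w_pos by (intro member_le_sum) auto
      also have "\<dots> = snd (\<Sum>S) + fst (\<Sum>S) * (M N + 1)"
        by (simp add: w_def sum.distrib fst_Sum snd_Sum sum_distrib_right)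
      also have "\<dots> \<le> B + N * (M N + 1)"
      proof (rule add_mono)
        have "\<bar>m (fst (\<Sum>S))\<bar> \<le> B"
          unfolding B_def using fst_nonneg S(3) by (intro member_le_sum) auto
        then show "snd (\<Sum>S) \<le> B" using S(4) by simp
        show "fst (\<Sum>S) * (M N + 1) \<le> N * (M N + 1)"
          using S(3) M_nonneg[of N] by (intro mult_right_mono) auto
      qed
      finally have "w p \<le> C" unfolding C_def .
      moreover have p: "0 \<le> fst p" "fst p \<le> N" using \<open>p \<in> S\<close> S J_fst[of p] fst_le[of p] by auto
      moreover have "0 \<le> fst p * (M N + 1)" "fst p * (M N + 1) \<le> N * (M N + 1)"
        using p M_nonneg[of N] by (auto intro: mult_right_mono)
      ultimately have "0 \<le> fst p \<and> fst p \<le> N \<and> - (N * (M N + 1)) \<le> snd p \<and> snd p \<le> C"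
        using w_pos[OF \<open>p \<in> S\<close>] unfolding w_def by linarith
      then show "p \<in> {0..N} \<times> {- (N * (M N + 1))..C}"
        by (cases p) auto
    qed
    then show ?thesis by (intro exI[of _ "{0..N} \<times> {- (N * (M N + 1))..C}"]) auto
  qed
  ultimately show ?thesis by (intro exI[of _ J]) blast
qed

lemma supp2_coeff2: "supp2 f = {p. coeff2 f p \<noteq> 0}"
  by (auto simp: supp2_def coeff2_def)

lemma pos_units_coeff2:
  "f \<in> pos_units \<longleftrightarrow> (\<forall>q. q \<notin> pos_exps \<longrightarrow> coeff2 f q = (if q = 0 then 1 else 0))"
  for f :: "'r::comm_ring_1 fls fls"
proof -
  have "f \<in> pos_units \<longleftrightarrow> (\<forall>q. coeff2 (f - 1) q \<noteq> 0 \<longrightarrow> q \<in> pos_exps)"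
    unfolding pos_units_def supp2_coeff2 by (simp only: mem_Collect_eq subset_iff)
  also have "\<dots> \<longleftrightarrow> (\<forall>q. q \<notin> pos_exps \<longrightarrow> coeff2 f q = (if q = 0 then 1 else 0))"
    unfolding coeff2_arith coeff2_1 right_minus_eq by blast
  finally show ?thesis .
qed

text \<open>In the coefficient at \<open>q\<close> the unknown \<open>a\<^sub>q\<close> occurs once, through the selection \<open>{q}\<close>; every other
selection with sum \<open>q\<close> consists of positive exponents smaller than \<open>q\<close>. Comparing coefficients is
therefore a recursion for \<open>a\<close> along the well-founded order on the set \<open>J\<close>.\<close>

lemma pos_units_has_prod2:
  fixes f :: "'r::comm_ring_1 fls fls"
  assumes f: "f \<in> pos_units"
  shows "\<exists>a. has_prod2 a pos_exps f"
proof -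
  obtain J where J_pos: "J \<subseteq> pos_exps" and J_supp: "\<forall>p\<in>pos_exps. coeff2 f p \<noteq> 0 \<longrightarrow> p \<in> J"
    and J_add: "\<forall>p\<in>J. \<forall>q\<in>J. p + q \<in> J" and wf: "wf {(p, q). p \<in> J \<and> q \<in> J \<and> p < q}"
    and J_box: "\<forall>N m. \<exists>K. finite K \<and> (\<forall>S. finite S \<longrightarrow> S \<subseteq> J \<longrightarrow> fst (\<Sum>S) < N \<longrightarrow>
        snd (\<Sum>S) < m (fst (\<Sum>S)) \<longrightarrow> S \<subseteq> K)"
    using supp_has_pos_cone[of f] by (elim exE conjE) (rule that)
  define R where "R = {(p, q). p \<in> J \<and> q \<in> J \<and> p < q}"
  define T where "T q = {S. finite S \<and> S \<subseteq> {p \<in> J. p < q} \<and> \<Sum>S = q}" for q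
  \<comment> \<open>The coefficient at \<open>q\<close> solved for \<open>a\<^sub>q\<close>; outside \<open>J\<close> the solution is \<open>0\<close>.\<close>
  define rec where "rec a q = (if q \<in> J then - coeff2 f q + (\<Sum>S\<in>T q. \<Prod>p\<in>S. - a p) else 0)"
    for a and q
  define a where "a = wfrec R rec"
  have a_rec: "a q = rec a q" for q
  proof -
    have "a q = rec (cut a R q) q"
      unfolding a_def by (rule wfrec) (use wf in \<open>simp add: R_def\<close>)
    also have "\<dots> = rec a q"
      unfolding rec_def
    proof (intro if_cong refl arg_cong2[where f = "(+)"] sum.cong prod.cong arg_cong[where f = uminus])
      fix S p assume "q \<in> J" "S \<in> T q" "p \<in> S"
      then have "(p, q) \<in> R" unfolding R_def T_def by auto
      then show "cut a R q p = a p" by (rule cut_apply)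
    qed
    finally show ?thesis .
  qed
  have J_Sum: "\<Sum>S \<in> J" if "finite S" "S \<noteq> {}" "S \<subseteq> J" for S
    by (rule Sum_closed[OF that J_add[rule_format]])
  have S_sub: "S \<subseteq> J" if "finite S" "(\<Prod>p\<in>S. - a p) \<noteq> 0" for S
  proof
    fix p assume "p \<in> S"
    with that have "a p \<noteq> 0" by (metis neg_0_equal_iff_equal prod_zero)
    then show "p \<in> J" unfolding a_rec[of p] rec_def by presburger
  qed
  have "admissible a pos_exps"
    unfolding admissible_def
  proof (intro allI)
    fix N m
    obtain K where "finite K" "\<forall>S. finite S \<longrightarrow> S \<subseteq> J \<longrightarrow> fst (\<Sum>S) < N \<longrightarrow>
        snd (\<Sum>S) < m (fst (\<Sum>S)) \<longrightarrow> S \<subseteq> K"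
      using J_box[rule_format, of N m] by blast
    with S_sub show "\<exists>K. finite K \<and>
     (\<forall>S. finite S \<longrightarrow> S \<subseteq> pos_exps \<longrightarrow> (\<Prod>p\<in>S. - a p) \<noteq> 0 \<longrightarrow> fst (\<Sum>S) < N \<longrightarrow>
        snd (\<Sum>S) < m (fst (\<Sum>S)) \<longrightarrow> S \<subseteq> K)"
      by (intro exI[of _ K]) simp
  qed
  then obtain x where x: "has_prod2 a pos_exps x" "\<forall>q. coeff2 x q = prod_coeff a pos_exps q"
    using has_prod2_exists by blast
  have "coeff2 x q = coeff2 f q" for q
  proof (cases "q \<in> pos_exps")
    case False
    have "prod_coeff a pos_exps q = (if q = 0 then 1 else 0)"
      by (rule prod_coeff_outside[OF exps_add(1) subset_refl False])
    then show ?thesis using False f x(2) unfolding pos_units_coeff2 by simp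
  next
    case True
    define U where "U = {S. finite S \<and> S \<subseteq> pos_exps \<and> (\<Prod>p\<in>S. - a p) \<noteq> 0 \<and> \<Sum>S = q}"
    have U_J: "S \<subseteq> J \<and> S \<noteq> {} \<and> q \<in> J" if "S \<in> U" for S
    proof -
      have "S \<subseteq> J" "finite S" "\<Sum>S = q" using that S_sub unfolding U_def by auto
      moreover have "S \<noteq> {}" using \<open>\<Sum>S = q\<close> True unfolding pos_exps_iff by auto
      ultimately show ?thesis using J_Sum[of S] by simp
    qed
    show ?thesis
    proof (cases "q \<in> J")
      case False
      then have "U = {}" using U_J by blast
      then have "coeff2 x q = 0" unfolding x(2)[rule_format] prod_coeff_def U_def[symmetric] by simp
      then show ?thesis using J_supp True False by metis
    next
      case q: True
      have fin: "finite (T q)"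
      proof -
        obtain K where K: "finite K" "\<forall>S. finite S \<longrightarrow> S \<subseteq> J \<longrightarrow> fst (\<Sum>S) < fst q + 1 \<longrightarrow>
            snd (\<Sum>S) < snd q + 1 \<longrightarrow> S \<subseteq> K"
          using J_box[rule_format, of "fst q + 1" "\<lambda>_. snd q + 1"] by blast
        have "T q \<subseteq> Pow K"
        proof
          fix S assume "S \<in> T q"
          then have "finite S" "S \<subseteq> J" "\<Sum>S = q" unfolding T_def by auto
          then show "S \<in> Pow K" using K(2) by simp
        qed
        then show ?thesis using K(1) by (meson finite_Pow_iff finite_subset)
      qed
      have "U \<subseteq> insert {q} (T q)"
      proof
        fix S assume S: "S \<in> U"
        then have "finite S" "\<Sum>S = q" "S \<subseteq> J" "S \<noteq> {}" using U_J unfolding U_def by auto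
        have smaller: "S = {p} \<and> p = q \<or> p < q" if "p \<in> S" for p
        proof (cases "S - {p} = {}")
          case True
          then have "S = {p}" using that by auto
          then show ?thesis using \<open>\<Sum>S = q\<close> by simp
        next
          case False
          have "\<Sum>(S - {p}) \<in> J"
            by (rule J_Sum[OF _ False]) (use \<open>finite S\<close> \<open>S \<subseteq> J\<close> in auto)
          with J_pos have "0 < \<Sum>(S - {p})" unfolding pos_exps_iff[symmetric] by (rule subsetD)
          moreover have "q = p + \<Sum>(S - {p})"
            using sum.remove[OF \<open>finite S\<close> that, of "\<lambda>p. p"] \<open>\<Sum>S = q\<close> by simp
          ultimately have "p < q"
            by (cases p; cases "\<Sum>(S - {p})") (simp add: zero_prod_def)
          then show ?thesis ..
        qed
        show "S \<in> insert {q} (T q)"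
        proof (cases "\<exists>p\<in>S. \<not> p < q")
          case True
          then obtain p where "p \<in> S" "\<not> p < q" by blast
          with smaller[of p] show ?thesis by simp
        next
          case False
          then show ?thesis using \<open>finite S\<close> \<open>\<Sum>S = q\<close> \<open>S \<subseteq> J\<close> unfolding T_def by auto
        qed
      qed
      moreover have "(\<Prod>p\<in>S. - a p) = 0" if "S \<in> insert {q} (T q) - U" for S
        using that J_pos q unfolding T_def U_def by auto
      ultimately have "coeff2 x q = (\<Sum>S\<in>insert {q} (T q). \<Prod>p\<in>S. - a p)"
        unfolding x(2)[rule_format] prod_coeff_def U_def[symmetric]
        by (intro sum.mono_neutral_left) (use fin in simp_all)
      also have "\<dots> = - a q + (\<Sum>S\<in>T q. \<Prod>p\<in>S. - a p)"
        using fin by (subst sum.insert) (auto simp: T_def)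
      also have "\<dots> = coeff2 f q"
        using q a_rec[of q] by (simp add: rec_def)
      finally show ?thesis .
    qed
  qed
  then have "x = f" by (rule coeff2_eqI)
  with x(1) show ?thesis by blast
qed

section \<open>Leading terms and the tame symbol\<close>

text \<open>The lexicographically first term. Since the order is compatible with addition, leading terms
multiply, and over a field they determine both the exponents and the constant in the tame symbol.\<close>

definition has_lead :: "'r::comm_ring_1 \<Rightarrow> int \<times> int \<Rightarrow> 'r fls fls \<Rightarrow> bool" where
  "has_lead c v f \<longleftrightarrow> coeff2 f v = c \<and> (\<forall>p<v. coeff2 f p = 0)"

lemma pos_units_has_lead: "f \<in> pos_units \<longleftrightarrow> has_lead 1 0 f"
proof -
  have "q \<notin> pos_exps \<longleftrightarrow> q < 0 \<or> q = 0" for q :: "int \<times> int"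
    unfolding pos_exps_iff by auto
  then show ?thesis unfolding pos_units_coeff2 has_lead_def by (metis less_irrefl)
qed

lemma has_lead_monom2: "has_lead c v (monom2 c v)"
  by (auto simp: has_lead_def coeff2_monom2)

lemma has_lead_mult:
  assumes "has_lead c v f" "has_lead d w g"
  shows "has_lead (c * d) (v + w) (f * g)"
proof -
  have less: "q - p < w" if "v < p" "q \<le> v + w" for p q
    using that by (cases p; cases q; cases v; cases w) auto
  have less': "q - p < w" if "v \<le> p" "q < v + w" for p q
    using that by (cases p; cases q; cases v; cases w) auto
  have "coeff2 (f * g) (v + w) = (\<Sum>p\<in>{v}. coeff2 f p * coeff2 g (v + w - p))"
  proof (rule coeff2_mult_superset)
    fix p assume "p \<notin> {v}"
    then have "p < v \<or> v < p" by auto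
    then show "coeff2 f p = 0 \<or> coeff2 g (v + w - p) = 0"
      using assms less[of p "v + w"] unfolding has_lead_def by blast
  qed simp
  moreover have "coeff2 (f * g) q = (\<Sum>p\<in>{}. coeff2 f p * coeff2 g (q - p))" if "q < v + w" for q
  proof (rule coeff2_mult_superset)
    fix p
    have "p < v \<or> v \<le> p" by auto
    then show "coeff2 f p = 0 \<or> coeff2 g (q - p) = 0"
      using assms less'[of p q] that unfolding has_lead_def by blast
  qed simp
  ultimately show ?thesis using assms by (simp add: has_lead_def)
qed

lemma has_lead_unique:
  assumes "has_lead c v f" "has_lead d w f" "c \<noteq> 0" "d \<noteq> 0"
  shows "v = w \<and> c = d"
  using assms unfolding has_lead_def by (metis neqE)

lemma has_lead_exists:
  assumes "f \<noteq> 0"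
  shows "\<exists>c v. c \<noteq> 0 \<and> has_lead c v f"
proof -
  define i where "i = fls_subdegree f"
  define j where "j = fls_subdegree (f $$ i)"
  have "f $$ i \<noteq> 0" unfolding i_def using assms by simp
  then have "f $$ i $$ j \<noteq> 0" unfolding j_def by simp
  moreover have "has_lead (f $$ i $$ j) (i, j) f"
    unfolding has_lead_def coeff2_def less_prod_def' by (auto simp: i_def j_def)
  ultimately show ?thesis by blast
qed

lemma has_lead_factor:
  assumes "has_lead (c :: 'k::field) v f" "c \<noteq> 0"
  shows "\<exists>g\<in>pos_units. f = monom2 c v * g"
proof
  have "monom2 c v * monom2 (1 / c) (- v) = 1"
    using assms(2) by (simp add: monom2_mult monom2_1_0)
  then show "f = monom2 c v * (monom2 (1 / c) (- v) * f)" by (simp flip: mult.assoc)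
  show "monom2 (1 / c) (- v) * f \<in> pos_units"
    using has_lead_mult[OF has_lead_monom2 assms(1), of "1 / c" "- v"] assms(2)
    by (simp add: pos_units_has_lead)
qed

lemma has_lead_powi:
  assumes "has_lead (c :: 'k::field) v f" "c \<noteq> 0"
  shows "has_lead (c powi n) (n * fst v, n * snd v) (f powi n)"
proof -
  have pow: "has_lead (d ^ m) (int m * fst w, int m * snd w) (g ^ m)"
    if "has_lead d w g" for d :: 'k and w g m
  proof (induction m)
    case 0
    show ?case by (auto simp: has_lead_def coeff2_1 zero_prod_def)
  next
    case (Suc m)
    have "w + (int m * fst w, int m * snd w) = (int (Suc m) * fst w, int (Suc m) * snd w)"
      by (cases w) (simp add: algebra_simps)
    then show ?case using has_lead_mult[OF that Suc] by simp
  qed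
  have nz: "f \<noteq> 0" using assms by (auto simp: has_lead_def)
  have inv: "has_lead (inverse c) (- v) (inverse f)"
  proof -
    obtain d w where d: "d \<noteq> 0" "has_lead d w (inverse f)"
      using has_lead_exists[of "inverse f"] nz by auto
    then have "has_lead (c * d) (v + w) 1" using has_lead_mult[OF assms(1) d(2)] nz by simp
    moreover have "has_lead (1::'k) 0 1" by (simp add: has_lead_def coeff2_1)
    ultimately have "v + w = 0" "c * d = 1" using has_lead_unique assms(2) d(1) by fastforce+
    then have "w = - v" "d = inverse c" using assms(2)
      by (simp_all add: eq_neg_iff_add_eq_0 add.commute field_simps)
    with d show ?thesis by simp
  qed
  show ?thesis
  proof (cases "n \<ge> 0")
    case True
    then show ?thesis using pow[OF assms(1), of "nat n"] by (simp add: power_int_def)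
  next
    case False
    then show ?thesis using pow[OF inv, of "nat (- n)"] by (simp add: power_int_def)
  qed
qed

lemma monom2_powi:
  "monom2 c (i, j) = const2 c * u_var powi j * t_var powi i" for c :: "'k::field"
  by (simp add: monom2_def unit_pow_field u_var_def t_var_def)

lemma tame_val_eq:
  assumes "has_lead (c :: 'k::field) v f" "c \<noteq> 0"
  shows "tame_val f = v"
proof -
  obtain i j where v: "v = (i, j)" by force
  have "(\<exists>d f1. d \<noteq> 0 \<and> f1 \<in> pos_units \<and> f = const2 d * u_var powi l * t_var powi k * f1)
      \<longleftrightarrow> (k, l) = v" (is "?L \<longleftrightarrow> ?R") for k l
  proof
    assume ?L
    then obtain d f1 where "d \<noteq> 0" "f1 \<in> pos_units" "f = monom2 d (k, l) * f1"
      unfolding monom2_powi by blast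
    then have "has_lead (d * 1) ((k, l) + 0) f"
      using has_lead_mult has_lead_monom2 pos_units_has_lead by blast
    with \<open>d \<noteq> 0\<close> show ?R using has_lead_unique[OF _ assms(1) _ assms(2)] by fastforce
  next
    assume ?R
    with has_lead_factor[OF assms] show ?L
      unfolding v monom2_powi using assms(2) by (auto simp: monom2_powi)
  qed
  then show ?thesis unfolding tame_val_def by (simp add: case_prod_unfold)
qed

text \<open>The exponents \<open>\<nu>(g,h), \<nu>(h,f), \<nu>(f,g)\<close> are the \<open>2 \<times> 2\<close> minors of the three exponent vectors, and
so the coefficients of the linear relation between them. The product whose reduction is taken has
therefore leading exponent \<open>0\<close>, and its reduction is its leading coefficient.\<close>

lemma tame_symbol_eq:
  assumes f: "has_lead (a :: 'k::field) x f" "a \<noteq> 0" and g: "has_lead b y g" "b \<noteq> 0"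
    and h: "has_lead c z h" "c \<noteq> 0"
  shows "tame_symbol f g h = (- 1) powi sign_exp x y z *
    (a powi nu_pair y z * b powi nu_pair z x * c powi nu_pair x y)"
proof -
  let ?s = "\<lambda>n v. (n * fst v, n * snd v) :: int \<times> int"
  have "?s (nu_pair y z) x + ?s (nu_pair z x) y + ?s (nu_pair x y) z = 0"
    by (simp add: nu_pair_def algebra_simps zero_prod_def)
  with has_lead_mult[OF has_lead_mult[OF has_lead_powi[OF f] has_lead_powi[OF g]] has_lead_powi[OF h],
      of "nu_pair y z" "nu_pair z x" "nu_pair x y"]
  have "has_lead (a powi nu_pair y z * b powi nu_pair z x * c powi nu_pair x y) 0
     (f powi nu_pair y z * g powi nu_pair z x * h powi nu_pair x y)"
    by (simp only:)
  then show ?thesis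
    unfolding tame_symbol_def Let_def tame_val_eq[OF f] tame_val_eq[OF g] tame_val_eq[OF h]
    by (simp add: has_lead_def coeff2_def)
qed

section \<open>Decompositions over a local ring with nilpotent principal maximal ideal\<close>

lemma has_prod2_cong:
  assumes "has_prod2 a I x" "\<And>p. p \<in> I \<Longrightarrow> a p = b p"
  shows "has_prod2 b I x"
proof -
  have "(\<Prod>p\<in>F. 1 - monom2 (b p) p) = (\<Prod>p\<in>F. 1 - monom2 (a p) p)" if "F \<subseteq> I" for F
    using assms(2) that by (intro prod.cong) auto
  then show ?thesis
    using assms(1) unfolding has_prod2_def eventually_finite_subsets_at_top by (simp cong: conj_cong)
qed

lemma has_prod2_shrink:
  assumes "has_prod2 a I x" "I' \<subseteq> I" "\<And>p. p \<in> I \<Longrightarrow> p \<notin> I' \<Longrightarrow> a p = 0"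
  shows "has_prod2 a I' x"
  unfolding has_prod2_def
proof (intro allI)
  fix m N
  let ?P = "\<lambda>F. (\<Prod>p\<in>F. 1 - monom2 (a p) p) - x \<in> nhd0 m N"
  have "eventually ?P (finite_subsets_at_top I)"
    using assms(1) unfolding has_prod2_def by blast
  then obtain F0 where F0: "finite F0" "F0 \<subseteq> I"
    "\<forall>F. finite F \<and> F0 \<subseteq> F \<and> F \<subseteq> I \<longrightarrow> ?P F"
    unfolding eventually_finite_subsets_at_top by (elim exE conjE) (rule that)
  have "?P F" if F: "finite F" "F0 \<inter> I' \<subseteq> F" "F \<subseteq> I'" for F
  proof -
    have "(\<Prod>p\<in>F \<union> F0. 1 - monom2 (a p) p) = (\<Prod>p\<in>F. 1 - monom2 (a p) p)"
    proof (rule prod.mono_neutral_right)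
      show "\<forall>p\<in>F \<union> F0 - F. 1 - monom2 (a p) p = 1"
      proof
        fix p assume "p \<in> F \<union> F0 - F"
        then have "a p = 0" using F(2) F0(2) by (intro assms(3)) auto
        then show "1 - monom2 (a p) p = 1" by simp
      qed
    qed (use F F0 in auto)
    moreover have "?P (F \<union> F0)"
      using F F0(1,2) assms(2) by (intro F0(3)[rule_format]) auto
    ultimately show ?thesis by simp
  qed
  then show "eventually ?P (finite_subsets_at_top I')"
    unfolding eventually_finite_subsets_at_top using F0(1) by (intro exI[of _ "F0 \<inter> I'"]) auto
qed

text \<open>Uniqueness modulo \<open>e\<close>. A selection with sum \<open>p\<close> other than \<open>{p}\<close> contains an exponent with a smaller
power of \<open>t\<close> or, for \<open>p\<close> without \<open>t\<close>, a smaller power of \<open>u\<close>. By induction its product is divisible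
by \<open>e\<close>, and so the coefficient of \<open>Y\<close> at \<open>p\<close> is \<open>-a\<^sub>p\<close> modulo \<open>e\<close>.\<close>

lemma has_prod2_pos_dvd:
  assumes prod: "has_prod2 a pos_exps Y" and Y: "coeffs_dvd e (Y - 1)" and p: "p \<in> pos_exps"
  shows "e dvd a p"
proof -
  define \<mu> where "\<mu> p = (nat (fst p), if fst p = 0 then nat (snd p) else 0)" for p :: "int \<times> int"
  have pos_fst: "0 \<le> fst p" and pos_snd: "fst p = 0 \<Longrightarrow> 1 \<le> snd p" if "p \<in> pos_exps" for p
    using that by (cases p; auto)+
  have "wf (inv_image (less_than <*lex*> less_than) \<mu>)"
    by (intro wf_inv_image wf_lex_prod wf_less_than)
  then show ?thesis using p
  proof (induction p rule: wf_induct_rule)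
    case (less p)
    show ?case
    proof (cases "a p = 0")
      case False
      obtain F where F: "finite F" "F \<subseteq> pos_exps"
        "\<forall>F'. finite F' \<and> F \<subseteq> F' \<and> F' \<subseteq> pos_exps \<longrightarrow> coeff2 Y p = prod_coeff a F' p"
        using has_prod2_finite_coeff[OF prod, of p] by (elim exE conjE) (rule that)
      define U where "U = {S. finite S \<and> S \<subseteq> insert p F \<and> (\<Prod>r\<in>S. - a r) \<noteq> 0 \<and> \<Sum>S = p}"
      have "U \<subseteq> Pow (insert p F)" unfolding U_def by auto
      then have fin: "finite U" using F(1) by (meson finite.insertI finite_Pow_iff finite_subset)
      have "coeff2 Y p = prod_coeff a (insert p F) p"
        using F less.prems by (intro F(3)[rule_format]) auto
      then have "coeff2 Y p = (\<Sum>S\<in>U. \<Prod>r\<in>S. - a r)"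
        unfolding prod_coeff_def U_def .
      also have "{p} \<in> U" unfolding U_def using False by simp
      then have "(\<Sum>S\<in>U. \<Prod>r\<in>S. - a r) = - a p + (\<Sum>S\<in>U - {{p}}. \<Prod>r\<in>S. - a r)"
        using fin by (subst sum.remove) auto
      finally have eq: "a p = (\<Sum>S\<in>U - {{p}}. \<Prod>r\<in>S. - a r) - coeff2 Y p" by simp
      have "p \<noteq> 0" using less.prems unfolding pos_exps_iff by simp
      with Y have "e dvd coeff2 Y p"
        unfolding coeffs_dvd_def coeff2_arith coeff2_1 by (metis diff_zero)
      moreover have "e dvd (\<Prod>r\<in>S. - a r)" if S: "S \<in> U - {{p}}" for S
      proof -
        have S': "finite S" "S \<subseteq> pos_exps" "\<Sum>S = p" "S \<noteq> {p}"
          using S F(2) less.prems unfolding U_def by auto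
        have "S \<noteq> {}" using S'(3) \<open>p \<noteq> 0\<close> by auto
        then obtain r where r: "r \<in> S" by blast
        have "S - {r} \<noteq> {}"
        proof
          assume "S - {r} = {}"
          then have "S = {r}" using r by auto
          then show False using S'(3,4) by simp
        qed
        then obtain r' where r': "r' \<in> S - {r}" by blast
        define s where "s = \<Sum>(S - {r})"
        have s: "s \<in> pos_exps" unfolding s_def
          by (rule Sum_closed[OF _ \<open>S - {r} \<noteq> {}\<close> _ exps_add(1)]) (use S' in auto)
        have p_eq: "p = r + s"
          using sum.remove[OF S'(1) r, of "\<lambda>p. p"] S'(3) by (simp add: s_def)
        have r_pos: "r \<in> pos_exps" "r' \<in> pos_exps" using r r' S'(2) by auto
        \<comment> \<open>If \<open>r\<close> has the same positive power of \<open>t\<close> as \<open>p\<close>, the others have none, so \<open>r'\<close> is smaller.\<close>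
        have "fst r' \<le> fst s" unfolding s_def fst_Sum
          using r' S'(1,2) pos_fst by (intro member_le_sum) auto
        then have "(r, p) \<in> inv_image (less_than <*lex*> less_than) \<mu> \<or>
            (r', p) \<in> inv_image (less_than <*lex*> less_than) \<mu>"
          using pos_fst[OF r_pos(1)] pos_fst[OF r_pos(2)] pos_snd[OF r_pos(1)] pos_fst[OF s] pos_snd[OF s]
          unfolding p_eq \<mu>_def by (auto simp: in_inv_image)
        then obtain q where "q \<in> S" "e dvd a q"
          using less.IH r_pos r r' by blast
        then show ?thesis using S'(1) by (meson dvd_minus_iff dvd_prodI dvd_trans)
      qed
      ultimately show ?thesis
        by (subst eq) (intro dvd_diff dvd_sum)
    qed simp
  qed
qed

lemma nilpotent_plus_1_unit:
  fixes z :: "'r::comm_ring_1"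
  assumes "z ^ n = 0" shows "1 + z dvd 1"
proof -
  have "(1 - (- z)) * (\<Sum>i<n. (- z) ^ i) = 1 - (- z) ^ n"
    using one_diff_power_eq[of "- z" n] by simp
  moreover have "(- z) ^ n = 0" using assms by (simp add: power_minus[of z])
  ultimately show ?thesis by (intro dvdI[of _ _ "\<Sum>i<n. (- z) ^ i"]) simp
qed

text \<open>The spectrum of such a ring is a single point and its idempotents are trivial, so locally constant
exponents become integers. A field is the case \<open>e = 0\<close>, and \<open>k[\<epsilon>]/\<epsilon>\<^sup>4\<close> the case \<open>e = \<epsilon>\<close>; treating
them together avoids doing the same reductions twice.\<close>

locale nilpotent_local =
  fixes e :: "'r::comm_ring_1" and N :: nat
  assumes e_nilpotent: "e ^ N = 0" and unit_mod_e: "\<And>x. \<not> e dvd x \<Longrightarrow> x dvd 1"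
begin

lemma not_dvd_1: "\<not> e dvd 1"
proof
  assume "e dvd 1"
  then have "e ^ N dvd 1 ^ N" by (rule dvd_power_same)
  then show False using e_nilpotent by simp
qed

lemma dvd_iff_nonunit: "e dvd x \<longleftrightarrow> \<not> x dvd 1"
  using unit_mod_e not_dvd_1 dvd_trans by blast

lemma nilpotent_imp_dvd: "nilpotent x \<Longrightarrow> e dvd x"
proof (rule ccontr)
  assume "nilpotent x" "\<not> e dvd x"
  then obtain n where n: "x ^ n = 0" "x dvd 1" using unit_mod_e unfolding nilpotent_def by blast
  then have "x ^ n dvd 1 ^ n" by (intro dvd_power_same)
  with n show False by simp
qed

abbreviation P0 :: "'r set" where "P0 \<equiv> {x. e dvd x}"

lemma prime_ideal_iff: "prime_ideal P \<longleftrightarrow> P = P0"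
proof
  assume P: "prime_ideal P"
  then have zero: "0 \<in> P" and ideal: "\<And>a x. x \<in> P \<Longrightarrow> a * x \<in> P" and one: "1 \<notin> P"
    and prime: "\<And>x y. x * y \<in> P \<Longrightarrow> x \<in> P \<or> y \<in> P"
    unfolding prime_ideal_def by blast+
  have "e \<in> P" if "e ^ n \<in> P" for n
    using that by (induction n) (use one prime in auto)
  then have "e \<in> P" using zero e_nilpotent by metis
  then have "P0 \<subseteq> P" using ideal by (auto simp: mult.commute elim!: dvdE)
  moreover have "e dvd x" if "x \<in> P" for x
  proof (rule ccontr)
    assume "\<not> e dvd x"
    then obtain y where "1 = x * y" using unit_mod_e by (blast elim: dvdE)
    then show False using ideal[OF that, of y] one by (simp add: mult.commute)
  qed
  ultimately show "P = P0" by auto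
next
  assume P: "P = P0"
  have "e dvd x \<or> e dvd y" if "e dvd x * y" for x y
    using that mult_dvd_mono[of x 1 y 1] unfolding dvd_iff_nonunit by auto
  then show "prime_ideal P"
    unfolding prime_ideal_def P using not_dvd_1 by auto
qed

lemma Spec_eq: "Spec = {P0}"
  unfolding Spec_def prime_ideal_iff by auto

lemma idempotent_cases:
  fixes x :: 'r
  assumes "x * x = x" shows "x = 0 \<or> x = 1"
proof -
  have zero: "x * (1 - x) = 0" using assms by (simp add: algebra_simps)
  have unit_zero: "y = 0" if "z dvd 1" "z * y = 0" for y z :: 'r
  proof -
    obtain w where "1 = z * w" using \<open>z dvd 1\<close> by (blast elim: dvdE)
    then have "y = w * (z * y)" by (metis mult.commute mult.left_commute mult_1)
    with that show ?thesis by simp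
  qed
  have "\<not> (e dvd x \<and> e dvd 1 - x)"
  proof
    assume "e dvd x \<and> e dvd 1 - x"
    then have "e dvd x + (1 - x)" by (intro dvd_add) auto
    then show False using not_dvd_1 by simp
  qed
  then have "x dvd 1 \<or> 1 - x dvd 1" unfolding dvd_iff_nonunit by auto
  then show ?thesis
  proof
    assume "x dvd 1"
    from unit_zero[OF this zero] show ?thesis by simp
  next
    assume "1 - x dvd 1"
    from unit_zero[OF this, of x] zero show ?thesis by (simp add: mult.commute)
  qed
qed

text \<open>The idempotent \<open>0\<close> imposes no condition on the power, and \<open>1\<close> fixes it.\<close>

lemma lc_pow_eq:
  assumes "\<iota> 0 = 0" "\<iota> (1 :: 'r) = 1"
  shows "lc_pow \<iota> x \<nu> = unit_pow x (\<nu> P0)"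
  unfolding lc_pow_def Spec_eq
proof (rule the_equality)
  show "\<forall>n c. c * c = c \<and> (\<forall>P\<in>{P0}. c \<notin> P \<longrightarrow> \<nu> P = n) \<longrightarrow>
      \<iota> c * unit_pow x (\<nu> P0) = \<iota> c * unit_pow x n"
  proof (intro allI impI)
    fix n c assume c: "c * c = c \<and> (\<forall>P\<in>{P0}. c \<notin> P \<longrightarrow> \<nu> P = n)"
    then have "c = 0 \<or> c = 1" by (intro idempotent_cases) simp
    then show "\<iota> c * unit_pow x (\<nu> P0) = \<iota> c * unit_pow x n"
    proof
      assume "c = 1"
      then have "\<nu> P0 = n" using c not_dvd_1 by simp
      then show ?thesis by simp
    qed (simp add: assms)
  qed
next
  fix y
  assume "\<forall>n c. c * c = c \<and> (\<forall>P\<in>{P0}. c \<notin> P \<longrightarrow> \<nu> P = n) \<longrightarrow> \<iota> c * y = \<iota> c * unit_pow x n"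
  from this[rule_format, of 1 "\<nu> P0"] show "y = unit_pow x (\<nu> P0)" by (simp add: assms)
qed

lemma lc_pow_id: "lc_pow id x \<nu> = unit_pow x (\<nu> P0)"
  by (rule lc_pow_eq) auto

lemma loc_const: "loc_const (\<nu> :: 'r set \<Rightarrow> int)"
  unfolding loc_const_def Spec_eq using not_dvd_1 by (auto intro!: exI[of _ 1])

text \<open>The exponents \<open>(\<nu>\<^sub>1, \<nu>\<^sub>2)\<close> at the only point of the spectrum.\<close>

definition nu :: "'r decomp \<Rightarrow> int \<times> int" where
  "nu D = (nu1 D P0, nu2 D P0)"

lemma lead_term:
  "const2 (lead D) * lc_pow const2 u_var (nu2 D) * lc_pow const2 t_var (nu1 D) = monom2 (lead D) (nu D)"
proof -
  have "const2 (0::'r) = 0" "const2 (1::'r) = 1"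
    by (rule coeff2_eqI, simp add: coeff2_const2 coeff2_1)+
  then show ?thesis unfolding nu_def monom2_def by (simp add: lc_pow_eq)
qed

lemma is_decomp_iff:
  "is_decomp f D \<longleftrightarrow> lead D dvd 1 \<and>
     (\<exists>X\<in>neg_units. \<exists>Y\<in>pos_units. f = X * (monom2 (lead D) (nu D) * Y) \<and> has_prod2 (cf D) pos_exps Y \<and>
        (\<exists>n m. n < 0 \<and> has_prod2 (cf D) {(i, j). (i, j) \<le> (0, -1) \<and> n < i \<and> m < j} X \<and>
           (\<forall>i j. (i, j) \<le> (0, -1) \<longrightarrow>
              nilpotent (cf D (i, j)) \<and> (\<not> (n < i \<and> m < j) \<longrightarrow> cf D (i, j) = 0))))"
proof -
  have "X * const2 (lead D) * lc_pow const2 u_var (nu2 D) * lc_pow const2 t_var (nu1 D) * Y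
      = X * (monom2 (lead D) (nu D) * Y)" for X Y
    unfolding lead_term[symmetric] by (simp only: mult.assoc)
  then show ?thesis unfolding is_decomp_def by (simp add: loc_const)
qed

lemma decomp_near_1_exists:
  assumes f: "coeffs_dvd e (f - 1)"
  shows "\<exists>D. is_decomp f D"
proof -
  obtain A X Y where A: "coeffs_dvd e A" and X: "has_prod2 (\<lambda>p. - coeff2 A p) neg_exps X"
    and Y: "has_prod2 (\<lambda>p. - coeff2 A p) pos_exps Y" and f_eq: "f = X * const2 (1 + coeff2 A 0) * Y"
    using nilpotent_factorization_exists[OF e_nilpotent f] by (elim exE conjE) (rule that)
  have A_dvd: "e dvd coeff2 A p" for p using A unfolding coeffs_dvd_def by blast
  define D where "D = \<lparr>lead = 1 + coeff2 A 0, nu1 = \<lambda>_. 0, nu2 = \<lambda>_. 0, cf = \<lambda>p. - coeff2 A p\<rparr>"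
  have nil: "x ^ N = 0" if "e dvd x" for x
    using dvd_power_same[OF that, of N] e_nilpotent by simp
  have lead: "lead D dvd 1" unfolding D_def using nilpotent_plus_1_unit[OF nil[OF A_dvd]] by simp
  have "nu D = 0" by (simp add: nu_def D_def zero_prod_def)
  moreover have "monom2 c 0 = const2 c" for c :: 'r
    by (rule coeff2_eqI) (simp add: coeff2_monom2 coeff2_const2)
  ultimately have f_eq': "f = X * (monom2 (lead D) (nu D) * Y)"
    using f_eq by (simp add: D_def mult.assoc)
  have "coeffs_dvd e (X - 1)" using has_prod2_near_1[OF X] A_dvd by simp
  then have "coeffs_dvd (e ^ N) ((X - 1) ^ N)" by (rule coeffs_dvd_power)
  then have "(X - 1) ^ N = 0" using e_nilpotent coeffs_dvd_zeroD by simp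
  then have X_neg: "X \<in> neg_units"
    unfolding neg_units_def nilpotent_def using supp2_has_prod2[OF X exps_add(2)] by blast
  have Y_pos: "Y \<in> pos_units"
    unfolding pos_units_def using supp2_has_prod2[OF Y exps_add(1)] by blast
  obtain n0 b where n0: "\<forall>i<n0. \<forall>j. coeff2 A (i, j) = 0" and b: "\<forall>i. \<forall>j<b i. coeff2 A (i, j) = 0"
    using coeff2_bounds[of A] by (elim exE conjE) (rule that)
  \<comment> \<open>The definition asks for strict inequalities and \<open>n < 0\<close>, which accounts for the subtractions of \<open>1\<close>.\<close>
  define n where "n = min n0 0 - 1"
  define m where "m = - (\<Sum>i\<in>{n..0}. \<bar>b i\<bar>) - 1"
  have out: "coeff2 A (i, j) = 0" if "(i, j) \<le> (0, -1 :: int)" "\<not> (n < i \<and> m < j)" for i j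
  proof (cases "n < i")
    case False
    then show ?thesis using n0 unfolding n_def by simp
  next
    case True
    with that have ij: "i \<le> 0" "j \<le> m" by auto
    have "\<bar>b i\<bar> \<le> (\<Sum>i\<in>{n..0}. \<bar>b i\<bar>)"
      using True ij(1) by (intro member_le_sum) auto
    then have "j < b i" using ij(2) unfolding m_def by linarith
    then show ?thesis using b by blast
  qed
  have "has_prod2 (cf D) {(i, j). (i, j) \<le> (0, -1) \<and> n < i \<and> m < j} X"
    unfolding D_def decomp.simps 
  proof (rule has_prod2_shrink[OF X])
    fix p assume "p \<in> neg_exps" "p \<notin> {(i, j). (i, j) \<le> (0, -1) \<and> n < i \<and> m < j}"
    then show "- coeff2 A p = 0" using out[of "fst p" "snd p"] by (cases p) auto
  qed auto
  moreover have "nilpotent (cf D p)" for p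
    unfolding nilpotent_def D_def using nil[of "- coeff2 A p"] A_dvd by auto
  moreover have "n < 0" unfolding n_def by simp
  moreover have "cf D (i, j) = 0" if "(i, j) \<le> (0, -1)" "\<not> (n < i \<and> m < j)" for i j
    using out[OF that] by (simp add: D_def)
  moreover have "has_prod2 (cf D) pos_exps Y" using Y by (simp add: D_def)
  ultimately have "is_decomp f D"
    unfolding is_decomp_iff using lead f_eq' X_neg Y_pos by blast
  then show ?thesis ..
qed

text \<open>The factor \<open>X\<close> is \<open>1\<close> modulo \<open>e\<close>, since nilpotent coefficients are divisible by \<open>e\<close>. The rest
\<open>y\<close> is then \<open>1\<close> modulo \<open>e\<close> as well, but its leading coefficient is a unit, so the leading exponent
must be \<open>0\<close>, and then the positive factor is \<open>1\<close> modulo \<open>e\<close>. Finally, modulo \<open>e\<^sup>2\<close> a product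
of factors near \<open>1\<close> is linear in their deviations from \<open>1\<close>. All of this holds for whichever decomposition
has been chosen.\<close>

lemma decomp_near_1:
  assumes f: "coeffs_dvd e (f - 1)" and D: "is_decomp f D"
  shows "nu D = 0" and "p \<noteq> 0 \<Longrightarrow> e ^ 2 dvd coeff2 f p + cf D p"
proof -
  from D obtain X Y n m where lead: "lead D dvd 1" and Y: "Y \<in> pos_units"
    and f_eq: "f = X * (monom2 (lead D) (nu D) * Y)" and Y_prod: "has_prod2 (cf D) pos_exps Y"
    and X_prod: "has_prod2 (cf D) {(i, j). (i, j) \<le> (0, -1) \<and> n < i \<and> m < j} X"
    and neg: "\<forall>i j. (i, j) \<le> (0, -1) \<longrightarrow>
              nilpotent (cf D (i, j)) \<and> (\<not> (n < i \<and> m < j) \<longrightarrow> cf D (i, j) = 0)"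
    unfolding is_decomp_iff by (elim exE conjE bexE) (rule that)
  define I where "I = {(i, j). (i, j) \<le> (0, -1) \<and> n < i \<and> m < j}"
  have I_neg: "I \<subseteq> neg_exps" unfolding I_def by auto
  have neg_dvd: "e dvd cf D p" if "p \<in> neg_exps" for p
    using neg[rule_format, of "fst p" "snd p"] that nilpotent_imp_dvd by simp
  have neg_zero: "cf D p = 0" if "p \<in> neg_exps" "p \<notin> I" for p
    using neg[rule_format, of "fst p" "snd p"] that unfolding I_def by (cases p) auto
  have X1: "coeffs_dvd e (X - 1)"
    by (rule has_prod2_near_1[OF X_prod[folded I_def]]) (use neg_dvd I_neg in blast)
  define y where "y = monom2 (lead D) (nu D) * Y"
  have "y - 1 = (f - 1) - (X - 1) * y" unfolding f_eq y_def by (simp add: algebra_simps)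
  also have "coeffs_dvd e \<dots>" by (intro coeffs_dvd_diff coeffs_dvd_mult_right f X1)
  finally have y1: "coeffs_dvd e (y - 1)" .
  have y_lead: "coeff2 y (nu D) = lead D"
    using has_lead_mult[OF has_lead_monom2 Y[unfolded pos_units_has_lead], of "lead D" "nu D"]
    unfolding y_def has_lead_def by simp
  have lead_nd: "\<not> e dvd lead D" using lead unfolding dvd_iff_nonunit by simp
  show nu0: "nu D = 0"
  proof (rule ccontr)
    assume "nu D \<noteq> 0"
    then have "e dvd lead D - 0"
      using y1[unfolded coeffs_dvd_def, rule_format, of "nu D"] y_lead by (simp add: coeff2_1)
    with lead_nd show False by simp
  qed
  have c1: "coeffs_dvd e (monom2 (lead D) 0 - 1)"
  proof -
    have "e dvd lead D - 1"
      using y1[unfolded coeffs_dvd_def, rule_format, of 0] y_lead nu0 by (simp add: coeff2_1)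
    then show ?thesis unfolding coeffs_dvd_def by (simp add: coeff2_monom2 coeff2_1)
  qed
  obtain v where v: "1 = lead D * v" using lead by (blast elim: dvdE)
  have "monom2 v 0 * monom2 (lead D) 0 = 1" using v by (simp add: monom2_mult mult.commute monom2_1_0)
  then have "Y = monom2 v 0 * y" unfolding y_def nu0 by (simp flip: mult.assoc)
  have "Y - 1 = monom2 v 0 * (y - 1) + monom2 v 0 * (1 - monom2 (lead D) 0)"
    unfolding right_diff_distrib \<open>monom2 v 0 * monom2 (lead D) 0 = 1\<close> \<open>Y = monom2 v 0 * y\<close>[symmetric]
    by simp
  also have "1 - monom2 (lead D) 0 = 0 - (monom2 (lead D) 0 - 1)" by simp
  finally have Y1: "coeffs_dvd e (Y - 1)"
    by (metis coeffs_dvd_add coeffs_dvd_mult_left coeffs_dvd_diff coeffs_dvd_0 y1 c1)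
  have pos_dvd: "e dvd cf D p" if "p \<in> pos_exps" for p
    by (rule has_prod2_pos_dvd[OF Y_prod Y1 that])
  assume p: "p \<noteq> 0"
  let ?c = "monom2 (lead D) 0"
  \<comment> \<open>All terms of order at least two in the product of \<open>X\<close>, \<open>?c\<close> and \<open>Y\<close>.\<close>
  have "(X - 1) * (y - 1) + (?c - 1) * (Y - 1) = f - X - ?c - Y + 1 + 1"
    unfolding f_eq y_def nu0 by (simp add: algebra_simps)
  moreover have "coeffs_dvd (e * e) ((X - 1) * (y - 1) + (?c - 1) * (Y - 1))"
    by (intro coeffs_dvd_add coeffs_dvd_mult X1 y1 c1 Y1)
  ultimately have "e ^ 2 dvd coeff2 (f - X - ?c - Y + 1 + 1) p"
    unfolding coeffs_dvd_def power2_eq_square by metis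
  then have 1: "e ^ 2 dvd coeff2 f p - coeff2 X p - coeff2 Y p"
    unfolding coeff2_arith coeff2_monom2 coeff2_1 using p by simp
  have 2: "e ^ 2 dvd coeff2 X p + (if p \<in> I then cf D p else 0)"
  proof -
    have "e dvd cf D q" if "q \<in> I" for q using neg_dvd I_neg that by blast
    from has_prod2_first_order[OF X_prod[folded I_def] this, of p] p show ?thesis
      by (simp add: coeff2_1)
  qed
  have 3: "e ^ 2 dvd coeff2 Y p + (if p \<in> pos_exps then cf D p else 0)"
    using has_prod2_first_order[OF Y_prod pos_dvd, of p] p by (simp add: coeff2_1)
  have "p \<in> neg_exps \<and> p \<notin> pos_exps \<or> p \<notin> neg_exps \<and> p \<in> pos_exps"
    using p unfolding pos_exps_iff neg_exps_iff by auto
  then have "(if p \<in> I then cf D p else 0) + (if p \<in> pos_exps then cf D p else 0) = cf D p"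
    using neg_zero[of p] I_neg by auto
  with dvd_add[OF dvd_add[OF 1 2] 3] show "e ^ 2 dvd coeff2 f p + cf D p"
    by (simp add: algebra_simps)
qed

lemma cc_symbol_eq:
  fixes f g h :: "'r fls fls"
  defines "F \<equiv> decomp_of f" and "G \<equiv> decomp_of g" and "H \<equiv> decomp_of h"
  shows "cc_symbol f g h = unit_pow (- 1) (sign_exp (nu F) (nu G) (nu H))
      * unit_pow (lead F) (nu_pair (nu G) (nu H))
      * unit_pow (lead G) (nu_pair (nu H) (nu F))
      * unit_pow (lead H) (nu_pair (nu F) (nu G))
      * prod' (\<lambda>(x, y, z). cc_T (cf F) (cf G) (cf H) x y z)
          ((- {(0, 0)}) \<times> (- {(0, 0)}) \<times> (- {(0, 0)}))
      * cc_SQ (cf F) (cf G) (nu1 H) (nu2 H)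
      * cc_SQ (cf H) (cf F) (nu1 G) (nu2 G)
      * cc_SQ (cf G) (cf H) (nu1 F) (nu2 F)"
  unfolding cc_symbol_def Let_def lc_pow_id nu_def F_def G_def H_def ..

lemma cc_SQ_eq_1:
  assumes "\<And>x y. x \<noteq> 0 \<Longrightarrow> y \<noteq> 0 \<Longrightarrow>
    unit_pow (cc_S a b x y) (\<nu>1 P0) * unit_pow (cc_Q a b x y) (\<nu>2 P0) = 1"
  shows "cc_SQ a b \<nu>1 \<nu>2 = 1"
proof -
  have "{p \<in> (- {(0, 0)}) \<times> (- {(0, 0)}).
      (case p of (x, y) \<Rightarrow> lc_pow id (cc_S a b x y) \<nu>1 * lc_pow id (cc_Q a b x y) \<nu>2) \<noteq> 1} = {}"
    using assms by (auto simp: lc_pow_id zero_prod_def)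
  then show ?thesis unfolding cc_SQ_def prod.G_def by simp
qed

end

section \<open>The symbol over a field\<close>

lemma prod'_eq_1: "(\<And>x. x \<in> I \<Longrightarrow> p x = 1) \<Longrightarrow> prod' p I = 1"
  unfolding prod.G_def by (simp cong: conj_cong)

lemma pos_or_neg: "x \<noteq> 0 \<Longrightarrow> x \<in> pos_exps \<or> x \<in> neg_exps" for x :: "int \<times> int"
  unfolding pos_exps_iff neg_exps_iff by auto

lemma pos_expsD: "(i, j) \<in> pos_exps \<Longrightarrow> 0 \<le> i \<and> (i = 0 \<longrightarrow> 0 < j)" for i j :: int
  by auto

text \<open>Dividing by the greatest common divisor taken with the common sign makes all quotients positive, so the
truncation to natural exponents in the factor \<open>T\<close> loses nothing.\<close>

lemma signed_gcd_quotients: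
  fixes p q r :: int
  assumes "(p > 0 \<and> q > 0 \<and> r > 0) \<or> (p < 0 \<and> q < 0 \<and> r < 0)"
  defines "d \<equiv> sgn p * gcd p (gcd q r)"
  shows "0 < p div d" "0 < q div d" "0 < r div d"
    "p = d * (p div d)" "q = d * (q div d)" "r = d * (r div d)" "d \<noteq> 0"
proof -
  have g: "0 < gcd p (gcd q r)" using assms by auto
  have dvd: "d dvd p" "d dvd q" "d dvd r"
    unfolding d_def using assms(1) by (auto simp: sgn_if intro: dvd_trans[OF gcd_dvd2])
  then show eq: "p = d * (p div d)" "q = d * (q div d)" "r = d * (r div d)" by simp_all
  show "d \<noteq> 0" unfolding d_def using g assms(1) by (auto simp: sgn_if)
  have sgn: "0 < d \<and> 0 < p \<or> d < 0 \<and> p < 0" "0 < d \<and> 0 < q \<or> d < 0 \<and> q < 0"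
    "0 < d \<and> 0 < r \<or> d < 0 \<and> r < 0"
    unfolding d_def using g assms(1) by (auto simp: sgn_if)
  have pos: "0 < y" if "x = d * y" "0 < d \<and> 0 < x \<or> d < 0 \<and> x < 0" for x y
    using that by (auto simp: zero_less_mult_iff mult_less_0_iff)
  show "0 < p div d" "0 < q div d" "0 < r div d"
    using pos[OF eq(1) sgn(1)] pos[OF eq(2) sgn(2)] pos[OF eq(3) sgn(3)] by auto
qed

text \<open>The linear relation \<open>p x + q y + r z = 0\<close> with coefficients of one sign cannot hold between three positive
exponents: their powers of \<open>t\<close> would vanish, and with them the minor \<open>p\<close>. So one exponent is
negative, where the coefficient is \<open>0\<close>.\<close>

lemma cc_T_eq_1:
  assumes zero: "\<And>p. p \<in> neg_exps \<Longrightarrow> a p = 0" "\<And>p. p \<in> neg_exps \<Longrightarrow> b p = 0"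
      "\<And>p. p \<in> neg_exps \<Longrightarrow> c p = 0"
    and nz: "x \<noteq> 0" "y \<noteq> 0" "z \<noteq> 0"
  shows "cc_T a b c x y z = 1"
proof -
  obtain i j k l m n where xyz: "x = (i, j)" "y = (k, l)" "z = (m, n)" by (metis surj_pair)
  define p q r where "p = l * m - n * k" and "q = n * i - j * m" and "r = j * k - l * i"
  define d where "d = sgn p * gcd p (gcd q r)"
  have T: "cc_T a b c x y z = (if (p > 0 \<and> q > 0 \<and> r > 0) \<or> (p < 0 \<and> q < 0 \<and> r < 0)
        then unit_pow (1 - a x ^ nat (p div d) * b y ^ nat (q div d) * c z ^ nat (r div d)) d
        else 1)"
    unfolding xyz cc_T_def Let_def p_def q_def r_def d_def by simp
  show ?thesis
  proof (cases "(p > 0 \<and> q > 0 \<and> r > 0) \<or> (p < 0 \<and> q < 0 \<and> r < 0)")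
    case True
    have "\<not> (x \<in> pos_exps \<and> y \<in> pos_exps \<and> z \<in> pos_exps)"
    proof
      assume "x \<in> pos_exps \<and> y \<in> pos_exps \<and> z \<in> pos_exps"
      then have ge: "0 \<le> i" "0 \<le> k" "0 \<le> m" unfolding xyz using pos_expsD by blast+
      have sum: "\<bar>p\<bar> * i + \<bar>q\<bar> * k + \<bar>r\<bar> * m = 0"
      proof -
        have "p * i + q * k + r * m = 0" unfolding p_def q_def r_def by (simp add: algebra_simps)
        then show ?thesis using True by auto
      qed
      have "0 \<le> \<bar>p\<bar> * i" "0 \<le> \<bar>q\<bar> * k" "0 \<le> \<bar>r\<bar> * m" using ge by auto
      with sum have "\<bar>p\<bar> * i = 0" "\<bar>q\<bar> * k = 0" "\<bar>r\<bar> * m = 0" by linarith+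
      then have "k = 0" "m = 0" using True by auto
      then have "p = 0" by (simp add: p_def)
      with True show False by simp
    qed
    then have "a x = 0 \<or> b y = 0 \<or> c z = 0" using pos_or_neg nz zero by blast
    moreover have "nat (p div d) \<noteq> 0" "nat (q div d) \<noteq> 0" "nat (r div d) \<noteq> 0"
      using signed_gcd_quotients(1-3)[OF True] unfolding d_def by simp_all
    ultimately have "a x ^ nat (p div d) * b y ^ nat (q div d) * c z ^ nat (r div d) = 0"
      by (metis mult_zero_left mult_zero_right power_0_left)
    then show ?thesis unfolding T by simp
  next
    case False
    then show ?thesis unfolding T by (rule if_not_P)
  qed
qed

text \<open>Parallel vectors with negative scalar product point in opposite directions, so they are not both positive.\<close>

lemma not_pos_pos_opposite:
  fixes i j k l :: int
  assumes "j * k - i * l = 0" "j * l + i * k < 0"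
  shows "\<not> ((i, j) \<in> pos_exps \<and> (k, l) \<in> pos_exps)"
proof
  assume "(i, j) \<in> pos_exps \<and> (k, l) \<in> pos_exps"
  then have ik: "0 \<le> i" "i = 0 \<longrightarrow> 0 < j" "0 \<le> k" "k = 0 \<longrightarrow> 0 < l" using pos_expsD by blast+
  then have "0 \<le> i * k" by simp
  with assms(2) have jl: "j * l < 0" by linarith
  show False
  proof (cases "i = 0")
    case True
    with ik jl have "l < 0" "0 < j" by (auto simp: mult_less_0_iff)
    moreover from this ik have "k \<noteq> 0" by auto
    ultimately show False using assms(1) True by simp
  next
    case False
    then have "0 < i" using ik by simp
    have "i * (j * l) = j * (i * l)" by (simp add: algebra_simps)
    also have "\<dots> = j * j * k" using assms(1) by simp
    also have "\<dots> \<ge> 0" using ik by simp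
    finally show False using mult_pos_neg[OF \<open>0 < i\<close> jl] by simp
  qed
qed

lemma nat_abs_div_gcd_neq_0:
  "x \<noteq> 0 \<Longrightarrow> nat \<bar>x div gcd x y\<bar> \<noteq> 0" "x \<noteq> 0 \<Longrightarrow> nat \<bar>x div gcd y x\<bar> \<noteq> 0" for x y :: int
  by (auto simp: div_eq_0_iff dvd_div_eq_0_iff)

lemma cc_S_cc_Q_eq_1:
  assumes zero: "\<And>p. p \<in> neg_exps \<Longrightarrow> a p = 0" "\<And>p. p \<in> neg_exps \<Longrightarrow> b p = 0"
    and nz: "x \<noteq> 0" "y \<noteq> 0"
  shows "cc_S a b x y = 1" "cc_Q a b x y = 1"
proof -
  obtain i j k l where xy: "x = (i, j)" "y = (k, l)" by (metis surj_pair)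
  have vanish: "a x = 0 \<or> b y = 0" if "j * k - i * l = 0" "j * l + i * k < 0"
    using not_pos_pos_opposite[OF that] pos_or_neg nz zero xy by blast
  show "cc_S a b x y = 1"
  proof (cases "j * k - i * l \<noteq> 0 \<or> j * l + i * k \<ge> 0 \<or> j * l = 0")
    case False
    then have "a x = 0 \<or> b y = 0" "j \<noteq> 0" "l \<noteq> 0" using vanish by auto
    then have "a x ^ nat \<bar>l div gcd j l\<bar> * b y ^ nat \<bar>j div gcd j l\<bar> = 0"
      using nat_abs_div_gcd_neq_0 by (metis mult_zero_left mult_zero_right power_0_left)
    then show ?thesis using False unfolding xy cc_S_def by simp
  qed (auto simp: xy cc_S_def)
  show "cc_Q a b x y = 1"
  proof (cases "j * k - i * l \<noteq> 0 \<or> j * l + i * k \<ge> 0 \<or> i * k = 0")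
    case False
    then have "a x = 0 \<or> b y = 0" "i \<noteq> 0" "k \<noteq> 0" using vanish by auto
    then have "a x ^ nat \<bar>k div gcd i k\<bar> * b y ^ nat \<bar>i div gcd i k\<bar> = 0"
      using nat_abs_div_gcd_neq_0 by (metis mult_zero_left mult_zero_right power_0_left)
    then show ?thesis using False unfolding xy cc_Q_def by simp
  qed (auto simp: xy cc_Q_def)
qed

interpretation field: nilpotent_local "0 :: 'k::field" 1
  by standard (auto simp: dvd_field_iff)

lemma field_decomp_exists:
  assumes "f \<noteq> (0 :: 'k::field fls fls)"
  shows "\<exists>D. is_decomp f D"
proof -
  obtain c v where c: "c \<noteq> 0" "has_lead c v f" using has_lead_exists[OF assms] by blast
  obtain g where g: "g \<in> pos_units" "f = monom2 c v * g"
    using has_lead_factor[OF c(2,1)] by blast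
  obtain a where a: "has_prod2 a pos_exps g" using pos_units_has_prod2[OF g(1)] by blast
  \<comment> \<open>The coefficients at negative exponents are unconstrained by \<open>a\<close>, hence set to \<open>0\<close>.\<close>
  define D where "D = \<lparr>lead = c, nu1 = \<lambda>_. fst v, nu2 = \<lambda>_. snd v,
    cf = \<lambda>p. if p \<in> pos_exps then a p else 0\<rparr>"
  have cf_neg: "cf D p = 0" if "p \<in> neg_exps" for p
    using that unfolding D_def decomp.simps pos_exps_iff neg_exps_iff by auto
  have "has_prod2 (cf D) pos_exps g"
    by (rule has_prod2_cong[OF a]) (simp add: D_def)
  moreover have "has_prod2 (cf D) {(i, j). (i, j) \<le> (0, -1) \<and> -1 < i \<and> 0 < j} 1"
    by (rule has_prod2_cong[OF has_prod2_0]) (use cf_neg in auto)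
  moreover have "(1 :: 'k fls fls) \<in> neg_units"
    unfolding neg_units_def nilpotent_def by (auto simp: supp2_coeff2 intro: exI[of _ 1])
  moreover have "f = 1 * (monom2 (lead D) (field.nu D) * g)"
    using g(2) by (simp add: D_def field.nu_def)
  moreover have "lead D dvd 1" using c(1) by (simp add: D_def dvd_field_iff)
  moreover have "nilpotent (cf D (i, j)) \<and> cf D (i, j) = 0" if "(i, j) \<le> (0, -1)" for i j
    using cf_neg[of "(i, j)"] that unfolding nilpotent_def by (auto intro: exI[of _ 1])
  moreover have "(- 1 :: int) < 0" by simp
  ultimately have "is_decomp f D"
    unfolding field.is_decomp_iff using g(1) by blast
  then show ?thesis ..
qed

text \<open>A field has no nilpotents besides \<open>0\<close>, so the negative factor is \<open>1\<close> and its coefficients vanish.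
What is left is the factorization that underlies the tame symbol.\<close>

lemma field_decomp:
  assumes "is_decomp f D" "f \<noteq> (0 :: 'k::field fls fls)"
  shows "lead D \<noteq> 0" "has_lead (lead D) (field.nu D) f" "p \<in> neg_exps \<Longrightarrow> cf D p = 0"
proof -
  from assms(1) obtain X Y n m where lead: "lead D dvd 1" and X: "X \<in> neg_units" and Y: "Y \<in> pos_units"
    and f_eq: "f = X * (monom2 (lead D) (field.nu D) * Y)"
    and neg: "\<forall>i j. (i, j) \<le> (0, -1) \<longrightarrow>
              nilpotent (cf D (i, j)) \<and> (\<not> (n < i \<and> m < j) \<longrightarrow> cf D (i, j) = 0)"
    unfolding field.is_decomp_iff by (elim exE conjE bexE) (rule that)
  show "lead D \<noteq> 0" using lead by auto
  have "X = 1" using X unfolding neg_units_def nilpotent_def by simp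
  then show "has_lead (lead D) (field.nu D) f"
    using has_lead_mult[OF has_lead_monom2 Y[unfolded pos_units_has_lead], of "lead D" "field.nu D"]
    unfolding f_eq by simp
  show "cf D p = 0" if "p \<in> neg_exps"
    using neg[rule_format, of "fst p" "snd p"] that unfolding nilpotent_def by simp
qed

text \<open>All factors \<open>T\<close>, \<open>S\<close> and \<open>Q\<close> are \<open>1\<close>, and the remaining sign and powers of leading coefficients are
those of the tame symbol.\<close>

lemma cc_symbol_field:
  assumes "f \<noteq> 0" "g \<noteq> 0" "h \<noteq> (0 :: 'k::field fls fls)"
  shows "cc_symbol f g h = tame_symbol f g h"
proof -
  have dec: "is_decomp x (decomp_of x)" if "x \<noteq> 0" for x :: "'k fls fls"
    unfolding decomp_of_def using field_decomp_exists[OF that] by (rule someI_ex)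
  note F = field_decomp[OF dec[OF assms(1)] assms(1)]
    and G = field_decomp[OF dec[OF assms(2)] assms(2)]
    and H = field_decomp[OF dec[OF assms(3)] assms(3)]
  have "prod' (\<lambda>(x, y, z). cc_T (cf (decomp_of f)) (cf (decomp_of g)) (cf (decomp_of h)) x y z)
      ((- {(0, 0)}) \<times> (- {(0, 0)}) \<times> (- {(0, 0)})) = 1"
    by (rule prod'_eq_1) (auto simp: zero_prod_def intro!: cc_T_eq_1 F(3) G(3) H(3))
  moreover have "cc_SQ a b \<nu>1 \<nu>2 = 1"
    if "\<And>p. p \<in> neg_exps \<Longrightarrow> a p = 0" "\<And>p. p \<in> neg_exps \<Longrightarrow> b p = 0"
    for a b :: "int \<times> int \<Rightarrow> 'k" and \<nu>1 \<nu>2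
  proof (rule field.cc_SQ_eq_1)
    fix x y :: "int \<times> int" assume "x \<noteq> 0" "y \<noteq> 0"
    with that have "cc_S a b x y = 1" "cc_Q a b x y = 1"
      by (auto intro!: cc_S_cc_Q_eq_1)
    then show "unit_pow (cc_S a b x y) (\<nu>1 {x. 0 dvd x}) * unit_pow (cc_Q a b x y) (\<nu>2 {x. 0 dvd x}) = 1"
      by simp
  qed
  ultimately show ?thesis
    unfolding field.cc_symbol_eq tame_symbol_eq[OF F(2,1) G(2,1) H(2,1)]
    by (simp add: F(1,3) G(1,3) H(1,3) unit_pow_field)
qed

section \<open>The residue as a sum over triples of exponents\<close>

text \<open>Three numbers bounded below whose sum is \<open>0\<close> are bounded above. This applies first to the exponents of \<open>t\<close>,
and then to those of \<open>u\<close>, for which the lower bounds on the finitely many remaining powers of \<open>t\<close> are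
uniform.\<close>

lemma finite_zero_sum_triples:
  fixes f g h :: "'r::comm_ring_1 fls fls"
  shows "finite {(x, y, z). x + y + z = 0 \<and> coeff2 f x \<noteq> 0 \<and> coeff2 g y \<noteq> 0 \<and> coeff2 h z \<noteq> 0}"
    (is "finite ?Z")
proof -
  obtain nf bf where f: "\<forall>i<nf. \<forall>j. coeff2 f (i, j) = 0" "\<forall>i. \<forall>j<bf i. coeff2 f (i, j) = 0"
    using coeff2_bounds[of f] by (elim exE conjE) (rule that)
  obtain ng bg where g: "\<forall>i<ng. \<forall>j. coeff2 g (i, j) = 0" "\<forall>i. \<forall>j<bg i. coeff2 g (i, j) = 0"
    using coeff2_bounds[of g] by (elim exE conjE) (rule that)
  obtain nh bh where h: "\<forall>i<nh. \<forall>j. coeff2 h (i, j) = 0" "\<forall>i. \<forall>j<bh i. coeff2 h (i, j) = 0"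
    using coeff2_bounds[of h] by (elim exE conjE) (rule that)
  define n where "n = \<bar>nf\<bar> + \<bar>ng\<bar> + \<bar>nh\<bar>"
  have n: "- n \<le> nf" "- n \<le> ng" "- n \<le> nh" unfolding n_def by linarith+
  define B where "B = (\<Sum>i\<in>{-n..2*n}. \<bar>bf i\<bar> + \<bar>bg i\<bar> + \<bar>bh i\<bar>)"
  have B: "- B \<le> bf i" "- B \<le> bg i" "- B \<le> bh i" if "i \<in> {-n..2*n}" for i
  proof -
    have "\<bar>bf i\<bar> + \<bar>bg i\<bar> + \<bar>bh i\<bar> \<le> B"
      unfolding B_def using that by (intro member_le_sum) auto
    then show "- B \<le> bf i" "- B \<le> bg i" "- B \<le> bh i" by linarith+
  qed
  let ?K = "{-n..2*n} \<times> {-B..2*B}"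
  have "?Z \<subseteq> ?K \<times> ?K \<times> ?K"
  proof
    fix t assume "t \<in> ?Z"
    moreover obtain i j k l m v where t: "t = ((i, j), (k, l), (m, v))" by (metis surj_pair)
    ultimately have sum: "(i, j) + (k, l) + (m, v) = 0"
      and nz: "coeff2 f (i, j) \<noteq> 0" "coeff2 g (k, l) \<noteq> 0" "coeff2 h (m, v) \<noteq> 0"
      by simp_all
    have s: "i + k + m = 0" "j + l + v = 0" using sum by (simp_all add: zero_prod_def)
    have "\<not> i < nf" "\<not> k < ng" "\<not> m < nh" using f(1) g(1) h(1) nz by blast+
    then have K: "i \<in> {-n..2*n}" "k \<in> {-n..2*n}" "m \<in> {-n..2*n}"
      using s(1) n by auto
    have "\<not> j < bf i" "\<not> l < bg k" "\<not> v < bh m" using f(2) g(2) h(2) nz by blast+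
    then have "j \<in> {-B..2*B}" "l \<in> {-B..2*B}" "v \<in> {-B..2*B}"
      using s(2) B(1)[OF K(1)] B(2)[OF K(2)] B(3)[OF K(3)] by auto
    with K show "t \<in> ?K \<times> ?K \<times> ?K" unfolding t by simp
  qed
  then show ?thesis by (rule finite_subset) simp
qed

text \<open>The set \<open>Z\<close> may be larger than the set of contributing triples. This matters in positive characteristic, where
the coefficients of a derivative vanish at exponents in the support of the series.\<close>

lemma coeff2_mult3:
  fixes f g h :: "'r::comm_ring_1 fls fls"
  assumes Z: "finite Z" "\<And>x y z. (x, y, z) \<in> Z \<Longrightarrow> x + y + z = 0"
    and out: "\<And>x y z. x + y + z = 0 \<Longrightarrow> (x, y, z) \<notin> Z \<Longrightarrow>
       coeff2 f x = 0 \<or> coeff2 g y = 0 \<or> coeff2 h z = 0"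
  shows "coeff2 (f * (g * h)) 0 = (\<Sum>(x, y, z)\<in>Z. coeff2 f x * coeff2 g y * coeff2 h z)"
proof -
  let ?P = "fst ` Z" and ?Q = "(fst \<circ> snd) ` Z"
  have fin: "finite ?P" "finite ?Q" using Z(1) by simp_all
  have outer: "coeff2 f x = 0 \<or> coeff2 (g * h) (0 - x) = 0" if "x \<notin> ?P" for x
  proof (cases "coeff2 f x = 0")
    case False
    have "coeff2 (g * h) (0 - x) = (\<Sum>y\<in>{}. coeff2 g y * coeff2 h (0 - x - y))"
    proof (rule coeff2_mult_superset)
      fix y :: "int \<times> int"
      have "(x, y, 0 - x - y) \<notin> Z" using that by force
      then show "coeff2 g y = 0 \<or> coeff2 h (0 - x - y) = 0"
        using out[of x y "0 - x - y"] False by auto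
    qed simp
    then show ?thesis by simp
  qed simp
  have inner: "coeff2 f x * coeff2 (g * h) (0 - x)
      = (\<Sum>y\<in>?Q. coeff2 f x * coeff2 g y * coeff2 h (0 - x - y))" for x
  proof (cases "coeff2 f x = 0")
    case False
    have "coeff2 (g * h) (0 - x) = (\<Sum>y\<in>?Q. coeff2 g y * coeff2 h (0 - x - y))"
    proof (rule coeff2_mult_superset[OF fin(2)])
      fix y assume "y \<notin> ?Q"
      then have "(x, y, 0 - x - y) \<notin> Z" by force
      then show "coeff2 g y = 0 \<or> coeff2 h (0 - x - y) = 0"
        using out[of x y "0 - x - y"] False by auto
    qed
    then show ?thesis by (simp add: sum_distrib_left mult.assoc)
  qed simp
  have "coeff2 (f * (g * h)) 0 = (\<Sum>x\<in>?P. coeff2 f x * coeff2 (g * h) (0 - x))"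
    by (rule coeff2_mult_superset[OF fin(1) outer])
  also have "\<dots> = (\<Sum>(x, y)\<in>?P \<times> ?Q. coeff2 f x * coeff2 g y * coeff2 h (0 - x - y))"
    unfolding inner sum.cartesian_product ..
  also have "\<dots> = (\<Sum>(x, y)\<in>(\<lambda>(x, y, z). (x, y)) ` Z. coeff2 f x * coeff2 g y * coeff2 h (0 - x - y))"
  proof (rule sum.mono_neutral_right)
    show "\<forall>p\<in>?P \<times> ?Q - (\<lambda>(x, y, z). (x, y)) ` Z.
        (case p of (x, y) \<Rightarrow> coeff2 f x * coeff2 g y * coeff2 h (0 - x - y)) = 0"
    proof (intro ballI, clarify)
      fix x y
      assume "(x, y) \<notin> (\<lambda>(x, y, z). (x, y)) ` Z"
      then have "(x, y, 0 - x - y) \<notin> Z" by force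
      then show "coeff2 f x * coeff2 g y * coeff2 h (0 - x - y) = 0"
        using out[of x y "0 - x - y"] by auto
    qed
  qed (use fin in force)+
  also have "\<dots> = (\<Sum>(x, y, z)\<in>Z. coeff2 f x * coeff2 g y * coeff2 h z)"
  proof (subst sum.reindex)
    have z: "snd (snd t) = 0 - fst t - fst (snd t)" if "t \<in> Z" for t
    proof -
      have "fst t + fst (snd t) + snd (snd t) = 0" by (rule Z(2)) (use that in simp)
      then show ?thesis by (simp add: add_eq_0_iff)
    qed
    show "inj_on (\<lambda>(x, y, z). (x, y)) Z"
    proof (rule inj_onI)
      fix s t assume "s \<in> Z" "t \<in> Z" "(case s of (x, y, z) \<Rightarrow> (x, y)) = (case t of (x, y, z) \<Rightarrow> (x, y))"
      then have "fst s = fst t" "fst (snd s) = fst (snd t)" "snd (snd s) = snd (snd t)"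
        using z by (simp_all add: case_prod_beta)
      then show "s = t" by (intro prod_eqI) simp_all
    qed
    show "sum ((\<lambda>(x, y). coeff2 f x * coeff2 g y * coeff2 h (0 - x - y)) \<circ> (\<lambda>(x, y, z). (x, y))) Z
        = (\<Sum>(x, y, z)\<in>Z. coeff2 f x * coeff2 g y * coeff2 h z)"
      using z by (intro sum.cong refl) (simp add: case_prod_beta)
  qed
  finally show ?thesis .
qed

lemma coeff2_deriv:
  "coeff2 (monom2 1 (0, 1) * deriv_u g) p = of_int (snd p) * coeff2 g p"
  "coeff2 (monom2 1 (1, 0) * deriv_t g) p = of_int (fst p) * coeff2 g p"
  for g :: "'r::comm_ring_1 fls fls"
proof -
  have of_int_nth: "(of_int n * x) $$ j = of_int n * x $$ j" for n j and x :: "'r fls"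
    by (simp add: fls_of_int)
  show "coeff2 (monom2 1 (0, 1) * deriv_u g) p = of_int (snd p) * coeff2 g p"
    "coeff2 (monom2 1 (1, 0) * deriv_t g) p = of_int (fst p) * coeff2 g p"
    unfolding coeff2_monom2_mult by (simp_all add: coeff2_def deriv_u_def deriv_t_def of_int_nth)
qed

text \<open>Multiplying by \<open>u t\<close> moves the residue to the constant coefficient and turns the derivatives into the operators
\<open>u \<partial>/\<partial>u\<close> and \<open>t \<partial>/\<partial>t\<close>, which act on monomials by their exponents. The wedge product then
contributes the determinant of the exponents of \<open>g\<close> and \<open>h\<close>.\<close>

lemma Res2_triple_sum:
  fixes f g h :: "'r::comm_ring_1 fls fls"
  defines "Z \<equiv> {(x, y, z). x + y + z = 0 \<and> coeff2 f x \<noteq> 0 \<and> coeff2 g y \<noteq> 0 \<and> coeff2 h z \<noteq> 0}"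
  shows "Res2 (f * wedge_d g h) =
    (\<Sum>(x, y, z)\<in>Z. of_int (nu_pair y z) * (coeff2 f x * coeff2 g y * coeff2 h z))"
proof -
  let ?u = "monom2 1 (0, 1) :: 'r fls fls" and ?t = "monom2 1 (1, 0) :: 'r fls fls"
  have fin: "finite Z" unfolding Z_def by (rule finite_zero_sum_triples)
  have "Res2 (f * wedge_d g h) = coeff2 (?u * ?t * (f * wedge_d g h)) 0"
    by (simp add: Res2_def monom2_mult coeff2_monom2_mult zero_prod_def) (simp add: coeff2_def)
  also have "?u * ?t * (f * wedge_d g h) =
      f * ((?u * deriv_u g) * (?t * deriv_t h)) - f * ((?t * deriv_t g) * (?u * deriv_u h))"
    unfolding wedge_d_def by (simp add: algebra_simps)
  also have "coeff2 \<dots> 0 = (\<Sum>(x, y, z)\<in>Z. coeff2 f x * (of_int (snd y) * coeff2 g y) * (of_int (fst z) * coeff2 h z))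
     - (\<Sum>(x, y, z)\<in>Z. coeff2 f x * (of_int (fst y) * coeff2 g y) * (of_int (snd z) * coeff2 h z))"
    unfolding coeff2_arith
    by (subst (1 2) coeff2_mult3[OF fin]) (auto simp: Z_def coeff2_deriv)
  also have "\<dots> = (\<Sum>(x, y, z)\<in>Z. of_int (nu_pair y z) * (coeff2 f x * coeff2 g y * coeff2 h z))"
    unfolding sum_subtractf[symmetric]
    by (intro sum.cong refl) (auto simp: nu_pair_def algebra_simps)
  finally show ?thesis .
qed

section \<open>The triple factors modulo a fourth power\<close>

lemma unit_pow_1_plus:
  fixes w :: "'r::comm_ring_1"
  assumes "w * w = 0" shows "unit_pow (1 + w) d = 1 + of_int d * w"
proof -
  have pow: "(1 + v) ^ n = 1 + of_nat n * v" if "v * v = 0" for v :: 'r and n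
  proof (induction n)
    case (Suc n)
    have "(1 + v) * (1 + of_nat n * v) = 1 + of_nat (Suc n) * v + of_nat n * (v * v)"
      by (simp add: algebra_simps)
    then show ?case using Suc that by simp
  qed simp
  have inv: "unit_inv (1 + w) = 1 + (- w)"
    by (rule unit_inv_eqI) (use assms in \<open>simp add: algebra_simps\<close>)
  show ?thesis
  proof (cases "d \<ge> 0")
    case True
    then show ?thesis using pow[OF assms, of "nat d"] by (simp add: unit_pow_def)
  next
    case False
    have "(- w) * (- w) = 0" using assms by simp
    from pow[OF this, of "nat (- d)"] False show ?thesis
      unfolding unit_pow_def inv by simp
  qed
qed

text \<open>The product in \<open>T\<close> has \<open>p/d + q/d + r/d\<close> factors divisible by \<open>e\<close>. As \<open>e\<^sup>4 = 0\<close>, it survives only if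
all three quotients are \<open>1\<close>, which means \<open>p = q = r = d\<close>; by the linear relation between the exponents this
happens exactly for \<open>x + y + z = 0\<close> with a nonzero minor \<open>p\<close>. The outer exponent \<open>d = p\<close> then becomes
the determinant in the residue formula, and of the three coefficients only the parts linear in \<open>e\<close> count.\<close>

lemma cc_T_nilpotent:
  fixes e :: "'r::comm_ring_1"
  assumes e: "e ^ 4 = 0"
    and a: "e ^ 2 dvd e * \<alpha> + a x" and b: "e ^ 2 dvd e * \<beta> + b y" and c: "e ^ 2 dvd e * \<gamma> + c z"
  shows "cc_T a b c x y z =
    (if x + y + z = 0 then 1 + e ^ 3 * (of_int (nu_pair y z) * (\<alpha> * \<beta> * \<gamma>)) else 1)"
proof -
  obtain i j k l m n where xyz: "x = (i, j)" "y = (k, l)" "z = (m, n)" by (metis surj_pair)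
  define p q r where "p = l * m - n * k" and "q = n * i - j * m" and "r = j * k - l * i"
  define d where "d = sgn p * gcd p (gcd q r)"
  have T: "cc_T a b c x y z = (if (p > 0 \<and> q > 0 \<and> r > 0) \<or> (p < 0 \<and> q < 0 \<and> r < 0)
        then unit_pow (1 - a x ^ nat (p div d) * b y ^ nat (q div d) * c z ^ nat (r div d)) d
        else 1)"
    unfolding xyz cc_T_def Let_def p_def q_def r_def d_def by simp
  have p_nu: "nu_pair y z = p" by (simp add: nu_pair_def xyz p_def)
  have relation: "p * i + q * k + r * m = 0" "p * j + q * l + r * n = 0"
    unfolding p_def q_def r_def by (simp_all add: algebra_simps)
  have pqr: "q = p \<and> r = p" if "x + y + z = 0"
  proof -
    have mn: "m = - i - k" "n = - j - l" using that by (auto simp: xyz zero_prod_def)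
    show ?thesis unfolding p_def q_def r_def mn by (simp add: algebra_simps)
  qed
  show ?thesis
  proof (cases "(p > 0 \<and> q > 0 \<and> r > 0) \<or> (p < 0 \<and> q < 0 \<and> r < 0)")
    case False
    with pqr have "x + y + z = 0 \<Longrightarrow> p = 0" by fastforce
    then show ?thesis unfolding T p_nu using False by auto
  next
    case True
    note d = signed_gcd_quotients[OF True, folded d_def]
    have dvd_e: "e dvd v" if "e ^ 2 dvd e * \<tau> + v" for v \<tau>
    proof -
      have "e dvd e ^ 2" by simp
      then have "e dvd (e * \<tau> + v) - e * \<tau>" using that by (intro dvd_diff) (auto intro: dvd_trans)
      then show ?thesis by simp
    qed
    note dvds = dvd_e[OF a] dvd_e[OF b] dvd_e[OF c]
    show ?thesis
    proof (cases "p div d = 1 \<and> q div d = 1 \<and> r div d = 1")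
      case one: True
      then have eq: "p = d" "q = d" "r = d" using d(4-6) by auto
      have "d * (i + k + m) = 0" "d * (j + l + n) = 0"
        using relation unfolding eq by (simp_all add: algebra_simps)
      then have sum: "x + y + z = 0" using d(7) by (simp add: xyz zero_prod_def)
      \<comment> \<open>Replacing one coefficient at a time by its linear part \<open>- e \<alpha>\<close>, \<open>- e \<beta>\<close>, \<open>- e \<gamma>\<close> costs a multiple of \<open>e\<^sup>4\<close>.\<close>
      have "e ^ 2 * e ^ 2 dvd a x * b y * c z + e ^ 3 * (\<alpha> * \<beta> * \<gamma>)"
      proof -
        have "e ^ 2 * e ^ 2 dvd (e * \<alpha> + a x) * (b y * c z)"
          unfolding power2_eq_square[of e] using a dvds by (intro mult_dvd_mono) (auto simp: power2_eq_square)
        moreover have "e ^ 2 * e ^ 2 dvd (e * \<beta> + b y) * ((e * \<alpha>) * c z)"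
          using b dvds by (intro mult_dvd_mono) (auto simp: power2_eq_square intro: mult_dvd_mono)
        moreover have "e ^ 2 * e ^ 2 dvd (e * \<gamma> + c z) * ((e * \<alpha>) * (e * \<beta>))"
          using c by (intro mult_dvd_mono) (auto simp: power2_eq_square intro: mult_dvd_mono)
        ultimately have "e ^ 2 * e ^ 2 dvd (e * \<alpha> + a x) * (b y * c z) - (e * \<beta> + b y) * ((e * \<alpha>) * c z)
            + (e * \<gamma> + c z) * ((e * \<alpha>) * (e * \<beta>))" by (intro dvd_add dvd_diff)
        also have "\<dots> = a x * b y * c z + e ^ 3 * (\<alpha> * \<beta> * \<gamma>)"
          by (simp add: algebra_simps power3_eq_cube)
        finally show ?thesis .
      qed
      moreover have "e ^ 2 * e ^ 2 = 0" using e by (simp flip: power_add)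
      ultimately have abc: "1 - a x * b y * c z = 1 + e ^ 3 * (\<alpha> * \<beta> * \<gamma>)"
        by (simp add: add_eq_0_iff)
      have "e ^ 3 * e ^ 3 = e ^ 4 * e ^ 2" by (simp flip: power_add)
      moreover have "e ^ 3 * w * (e ^ 3 * w) = (e ^ 3 * e ^ 3) * (w * w)" for w
        by (simp only: mult_ac)
      ultimately have "e ^ 3 * w * (e ^ 3 * w) = 0" for w by (simp add: e)
      then have "unit_pow (1 + e ^ 3 * (\<alpha> * \<beta> * \<gamma>)) d = 1 + of_int d * (e ^ 3 * (\<alpha> * \<beta> * \<gamma>))"
        by (intro unit_pow_1_plus)
      moreover have "cc_T a b c x y z = unit_pow (1 - a x * b y * c z) d"
        unfolding T using True one by simp
      ultimately show ?thesis
        using sum by (simp only: abc p_nu eq(1) if_True simp_thms mult.left_commute)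
    next
      case False
      have "x + y + z \<noteq> 0"
      proof
        assume "x + y + z = 0"
        then have eq: "q = p" "r = p" using pqr by auto
        then have "d = p" unfolding d_def by (simp add: sgn_mult_abs)
        then show False using False eq d(7) by simp
      qed
      moreover have "a x ^ nat (p div d) * b y ^ nat (q div d) * c z ^ nat (r div d) = 0"
      proof -
        have "4 \<le> nat (p div d) + nat (q div d) + nat (r div d)"
          using False d(1-3) by linarith
        then have "e ^ 4 dvd e ^ (nat (p div d) + nat (q div d) + nat (r div d))"
          by (rule le_imp_power_dvd)
        also have "\<dots> dvd a x ^ nat (p div d) * b y ^ nat (q div d) * c z ^ nat (r div d)"
          unfolding power_add using dvds by (intro mult_dvd_mono dvd_power_same)
        finally show ?thesis using e by simp
      qed
      ultimately show ?thesis unfolding T by simp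
    qed
  qed
qed

lemma prod_1_plus:
  fixes \<epsilon> :: "'r::comm_ring_1"
  assumes "\<epsilon> * \<epsilon> = 0"
  shows "(\<Prod>x\<in>A. 1 + \<epsilon> * w x) = 1 + \<epsilon> * (\<Sum>x\<in>A. w x)"
proof (induction A rule: infinite_finite_induct)
  case (insert x A)
  have "(1 + \<epsilon> * w x) * (1 + \<epsilon> * sum w A)
      = 1 + \<epsilon> * (w x + sum w A) + \<epsilon> * \<epsilon> * (w x * sum w A)"
    by (simp add: algebra_simps)
  then show ?case using insert assms by simp
qed auto

section \<open>The symbol over the truncated polynomial ring\<close>

lemma eps_pow_4: "(eps :: 'k::field eps4) ^ 4 = 0"
proof -
  have X: "monom 1 4 = [:0, 1:] * ([:0, 1:] * ([:0, 1:] * ([:0, 1:] :: 'k poly)))"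
    unfolding monom_altdef power4_eq_xxxx mult.assoc by simp
  have "(eps :: 'k eps4) * (eps * (eps * eps)) = 0"
    by transfer (simp only: X diff_zero dvd_refl)
  then show ?thesis by (simp add: power4_eq_xxxx mult.assoc)
qed

lemma eps4_const_simps:
  "eps4_const 0 = 0" "eps4_const 1 = 1"
  "eps4_const (a + b) = eps4_const a + eps4_const b"
  "eps4_const (- a) = - eps4_const a"
  "eps4_const (a * b) = eps4_const a * eps4_const b"
  by (transfer; simp add: one_pCons)+

lemma eps4_const_of_nat: "eps4_const (of_nat n) = of_nat n"
  by (induction n) (simp_all add: eps4_const_simps)

lemma eps4_const_of_int: "eps4_const (of_int n) = of_int n"
  by (cases n rule: int_diff_cases) (simp add: eps4_const_simps eps4_const_of_nat flip: add_uminus_conv_diff)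

lemma eps4_const_sum: "eps4_const (\<Sum>x\<in>A. f x) = (\<Sum>x\<in>A. eps4_const (f x))"
  by (induction A rule: infinite_finite_induct) (simp_all add: eps4_const_simps)

lemma eps4_cases: "\<exists>c s. x = eps4_const c + eps * s"
proof transfer
  fix x :: "'a poly"
  obtain c q where "x = pCons c q" by (rule pCons_cases)
  then show "\<exists>c s. monom 1 4 dvd x - ([:c:] + [:0, 1:] * s)"
    by (intro exI[of _ c] exI[of _ q]) simp
qed

interpretation eps4: nilpotent_local "eps :: 'k::field eps4" 4
proof
  show "(eps :: 'k eps4) ^ 4 = 0" by (rule eps_pow_4)
next
  fix x :: "'k eps4" assume nd: "\<not> eps dvd x"
  obtain c s where x: "x = eps4_const c + eps * s" using eps4_cases by blast
  with nd have "c \<noteq> 0" by (auto simp: eps4_const_simps)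
  then have "eps4_const c * eps4_const (inverse c) = 1"
    by (simp flip: eps4_const_simps)
  then have "x * eps4_const (inverse c) = 1 + eps * (s * eps4_const (inverse c))"
    unfolding x by (simp add: algebra_simps)
  moreover have "1 + eps * (s * eps4_const (inverse c)) dvd 1"
    by (rule nilpotent_plus_1_unit[of _ 4]) (simp add: power_mult_distrib eps_pow_4)
  ultimately show "x dvd 1" by (metis dvd_mult_left)
qed

lemma coeff2_embed2: "coeff2 (1 + const2 eps * embed2 f) p
    = (if p = 0 then 1 else 0) + eps * eps4_const (coeff2 f p)"
proof -
  have "fls_map eps4_const (0 :: 'a fls) = 0"
    by (rule fls_eqI) (simp add: eps4_const_simps)
  then show ?thesis
    by (simp add: coeff2_const2_mult coeff2_1) (simp add: coeff2_def embed2_def eps4_const_simps)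
qed

text \<open>The leading exponents are \<open>0\<close>, so the sign, the leading coefficients and all \<open>S\<close> and \<open>Q\<close> enter with
exponent \<open>0\<close>. Since \<open>\<epsilon>\<^sup>3 \<epsilon>\<^sup>3 = 0\<close>, the product of the factors \<open>T\<close> for triples with
\<open>x + y + z = 0\<close> is \<open>1\<close> plus the sum in the residue formula. Triples with a zero exponent are missing in the product, but
their determinant is \<open>0\<close>.\<close>

lemma cc_symbol_eps4:
  fixes f g h :: "'k::field fls fls"
  shows "cc_symbol (1 + const2 eps * embed2 f) (1 + const2 eps * embed2 g) (1 + const2 eps * embed2 h)
     = 1 + eps ^ 3 * eps4_const (Res2 (f * wedge_d g h))"
proof -
  let ?E = "\<lambda>f :: 'k fls fls. 1 + const2 eps * embed2 f"
  have near: "coeffs_dvd eps (?E f - 1)" for f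
    unfolding coeffs_dvd_def by (simp only: coeff2_arith(3) coeff2_embed2 coeff2_1) simp
  have dec: "is_decomp (?E f) (decomp_of (?E f))" for f
    unfolding decomp_of_def using eps4.decomp_near_1_exists[OF near] by (rule someI_ex)
  define F G H where "F = decomp_of (?E f)" and "G = decomp_of (?E g)" and "H = decomp_of (?E h)"
  have nu: "eps4.nu F = 0" "eps4.nu G = 0" "eps4.nu H = 0"
    unfolding F_def G_def H_def by (rule eps4.decomp_near_1(1)[OF near dec])+
  have cf: "eps ^ 2 dvd eps * eps4_const (coeff2 f p) + cf (decomp_of (?E f)) p" if "p \<noteq> 0" for f p
    using eps4.decomp_near_1(2)[OF near dec that] that unfolding coeff2_embed2 by simp
  define Z where "Z = {(x, y, z). x + y + z = 0 \<and> coeff2 f x \<noteq> 0 \<and> coeff2 g y \<noteq> 0 \<and> coeff2 h z \<noteq> 0}"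
  define w where "w = (\<lambda>(x, y, z). eps4_const (of_int (nu_pair y z) * (coeff2 f x * coeff2 g y * coeff2 h z)))"
  define I where "I = (- {(0::int, 0::int)}) \<times> (- {(0::int, 0::int)}) \<times> (- {(0::int, 0::int)})"
  let ?T = "\<lambda>(x, y, z). cc_T (cf F) (cf G) (cf H) x y z"
  have fin: "finite Z" unfolding Z_def by (rule finite_zero_sum_triples)
  have T: "?T (x, y, z) = (if x + y + z = 0 then 1 + eps ^ 3 * w (x, y, z) else 1)"
    if "(x, y, z) \<in> I" for x y z
    unfolding w_def case_prod_conv eps4_const_simps eps4_const_of_int F_def G_def H_def
    by (rule cc_T_nilpotent[OF eps_pow_4]; rule cf) (use that in \<open>auto simp: I_def zero_prod_def\<close>)
  have w_zero: "w t = 0" if "t \<in> Z - I" for t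
  proof -
    obtain x y z where t: "t = (x, y, z)" by (rule prod_cases3)
    have sum: "x + y + z = 0" "x = 0 \<or> y = 0 \<or> z = 0"
      using that unfolding t Z_def I_def zero_prod_def[symmetric] by auto
    have "nu_pair y z = 0" using sum
      by (cases x; cases y; cases z) (auto simp: nu_pair_def zero_prod_def add_eq_0_iff)
    then show ?thesis by (simp add: w_def t eps4_const_simps)
  qed
  have T_Z: "?T t = 1 + eps ^ 3 * w t" if "t \<in> Z" "t \<in> I" for t
  proof -
    obtain x y z where t: "t = (x, y, z)" by (rule prod_cases3)
    have "x + y + z = 0" using that(1) unfolding t Z_def by simp
    then show ?thesis using T[of x y z] that(2) unfolding t by simp
  qed
  have T_out: "?T t = 1" if "t \<in> I" "t \<notin> Z" for t
  proof -
    obtain x y z where t: "t = (x, y, z)" by (rule prod_cases3)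
    have "w t = 0" if "x + y + z = 0"
      using \<open>t \<notin> Z\<close> that unfolding t Z_def w_def by (auto simp: eps4_const_simps)
    then show ?thesis using T[of x y z] that(1) unfolding t by (cases "x + y + z = 0") simp_all
  qed
  have sub: "{t \<in> I. ?T t \<noteq> 1} \<subseteq> Z" using T_out by blast
  then have "finite {t \<in> I. ?T t \<noteq> 1}" using fin by (rule finite_subset)
  then have "prod' ?T I = (\<Prod>t\<in>{t \<in> I. ?T t \<noteq> 1}. ?T t)"
    unfolding prod.G_def by (rule if_P)
  also have "\<dots> = (\<Prod>t\<in>Z. 1 + eps ^ 3 * w t)"
  proof (rule prod.mono_neutral_cong_left[OF fin sub])
    show "\<forall>t\<in>Z - {t \<in> I. ?T t \<noteq> 1}. 1 + eps ^ 3 * w t = 1"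
    proof
      fix t assume t: "t \<in> Z - {t \<in> I. ?T t \<noteq> 1}"
      show "1 + eps ^ 3 * w t = 1"
      proof (cases "t \<in> I")
        case True
        with t have "?T t = 1" by blast
        then show ?thesis using T_Z[of t] t True by simp
      next
        case False
        then show ?thesis using w_zero[of t] t by simp
      qed
    qed
    show "?T t = 1 + eps ^ 3 * w t" if "t \<in> {t \<in> I. ?T t \<noteq> 1}" for t
      by (rule T_Z) (use that sub in blast)+
  qed
  also have "\<dots> = 1 + eps ^ 3 * (\<Sum>t\<in>Z. w t)"
  proof (rule prod_1_plus)
    have "(eps :: 'k eps4) ^ 3 * eps ^ 3 = eps ^ 4 * eps ^ 2" by (simp flip: power_add)
    then show "(eps :: 'k eps4) ^ 3 * eps ^ 3 = 0" by (simp add: eps_pow_4)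
  qed
  also have "(\<Sum>t\<in>Z. w t) = eps4_const (Res2 (f * wedge_d g h))"
    unfolding Res2_triple_sum Z_def[symmetric] eps4_const_sum w_def by (intro sum.cong refl) auto
  finally have "prod' ?T I = 1 + eps ^ 3 * eps4_const (Res2 (f * wedge_d g h))" .
  moreover have "cc_SQ a b (nu1 D) (nu2 D) = 1" if "eps4.nu D = 0"
    for a b and D :: "'k eps4 decomp"
  proof -
    have "nu1 D eps4.P0 = 0" "nu2 D eps4.P0 = 0"
      using that unfolding eps4.nu_def by (simp_all add: zero_prod_def)
    then show ?thesis by (intro eps4.cc_SQ_eq_1) simp
  qed
  moreover have "sign_exp 0 0 0 = 0" "nu_pair 0 0 = 0" by (simp_all add: sign_exp_def nu_pair_def)
  ultimately show ?thesis
    unfolding eps4.cc_symbol_eq F_def[symmetric] G_def[symmetric] H_def[symmetric] nu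
    by (simp add: nu I_def)
qed

theorem proposition4p3:
  shows "(\<forall>f g h :: 'k::field fls fls. f \<noteq> 0 \<and> g \<noteq> 0 \<and> h \<noteq> 0 \<longrightarrow>
            cc_symbol f g h = tame_symbol f g h) \<and>
         (\<forall>f g h :: 'k fls fls.
            cc_symbol (1 + const2 eps * embed2 f) (1 + const2 eps * embed2 g)
                (1 + const2 eps * embed2 h)
              = 1 + eps ^ 3 * eps4_const (Res2 (f * wedge_d g h)))"
  by (simp add: cc_symbol_field cc_symbol_eps4)

end
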